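(* Let $c\in\{1,-1\}$ and let $f\colon M^n\to\mathbb{Q}^n_c\times\mathbb{R}$ be an isoparametric hypersurface having $T$ as a principal direction. Then $f$ has constant principal curvatures if and only if $\|T\|$ is constant.
   Context: $\mathbb{Q}^n_c$ denotes the unit sphere $\mathbb{S}^n$ if $c=1$ and the hyperbolic space $\mathbb{H}^n$ (curvature $-1$) if $c=-1$. A hypersurface $f\colon M^n\to\mathbb{Q}^n_c\times\mathbb{R}$ is an isometric immersion of a (connected) Riemannian $n$-manifold with unit normal field $\eta$ and shape operator $A$; principal curvatures are the eigenvalues of $A$. With $\partial/\partial t$ the unit vector field tangent to the factor $\mathbb{R}$, the tangent vector field $T$ on $M^n$ and the smooth function $\nu$ are defined by $\partial/\partial t=df(T)+\nu\eta$; thus $\nu^2+\|T\|^2=1$. "$T$ is a principal direction" means that $T$ is nowhere zero and is at every point an eigenvector of $A$. The hypersurfaces parallel to $f$ are $f_t(p)=\exp_{f(p)}(t\,\eta(p))$, where $\exp$ is the exponential map of $\mathbb{Q}^n_c\times\mathbb{R}$. The hypersurface $f$ is isoparametric if its parallel hypersurfaces $f_t$ (for $t$ near $0$, locally on $M^n$, where $f_t$ is an immersion) all have constant mean curvature, $f_0=f$ included.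
   Formalization: The dimension n of M^n is assumed to be at least 2; for n = 1 the claim fails, e.g. for a circular arc without horizontal tangents in the flat cylinder S^1 × R, where the curvature is constant but ‖T‖ is not. *)

theory Defs
  imports "HOL-Analysis.Analysis"
begin

text \<open>Smooth maps between Euclidean spaces; used only for open \<open>S\<close>.\<close>

primrec Ck_on :: "nat \<Rightarrow> 'a::euclidean_space set \<Rightarrow> ('a \<Rightarrow> 'b::real_normed_vector) \<Rightarrow> bool" where
  "Ck_on 0 S F \<longleftrightarrow> continuous_on S F"
| "Ck_on (Suc k) S F \<longleftrightarrow>
     (\<forall>x\<in>S. F differentiable (at x)) \<and> (\<forall>v. Ck_on k S (\<lambda>x. frechet_derivative F (at x) v))"

definition smooth_on :: "'a::euclidean_space set \<Rightarrow> ('a \<Rightarrow> 'b::real_normed_vector) \<Rightarrow> bool" where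
  "smooth_on S F \<longleftrightarrow> (\<forall>k. Ck_on k S F)"


text \<open>
  Manifolds. A chart is a pair \<open>(U, \<phi>)\<close> of a domain and a coordinate map into \<open>real^'n\<close>, so that
  the dimension is \<open>CARD('n)\<close>. A tangent vector at a point of \<open>U\<close> is represented by its components
  in the chart; pointwise notions carry the chart as a parameter, and assertions about them
  are made for every chart of the atlas around the point.
\<close>

type_synonym ('m, 'n) chart = "'m set \<times> ('m \<Rightarrow> real^'n)"

definition smooth_manifold :: "'m topology \<Rightarrow> ('m, 'n::finite) chart set \<Rightarrow> bool" where
  "smooth_manifold X \<A> \<longleftrightarrow>
     Hausdorff_space X \<and> second_countable X \<and>
     (\<forall>(U, \<phi>)\<in>\<A>. openin X U \<and> open (\<phi> ` U) \<and>
        homeomorphic_map (subtopology X U) (top_of_set (\<phi> ` U)) \<phi>) \<and>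
     \<Union> (fst ` \<A>) = topspace X \<and>
     (\<forall>(U, \<phi>)\<in>\<A>. \<forall>(V, \<psi>)\<in>\<A>. smooth_on (\<phi> ` (U \<inter> V)) (\<psi> \<circ> inv_into U \<phi>))"

definition smooth_map_on ::
    "('m, 'n::finite) chart set \<Rightarrow> 'm set \<Rightarrow> ('m \<Rightarrow> 'b::real_normed_vector) \<Rightarrow> bool" where
  "smooth_map_on \<A> W F \<longleftrightarrow> (\<forall>(U, \<phi>)\<in>\<A>. smooth_on (\<phi> ` (U \<inter> W)) (F \<circ> inv_into U \<phi>))"

text \<open>\<open>dif K F p v\<close> is \<open>dF\<^sub>p\<close> applied to the tangent vector with components \<open>v\<close> in the chart \<open>K\<close>.\<close>

definition dif ::
    "('m, 'n::finite) chart \<Rightarrow> ('m \<Rightarrow> 'b::real_normed_vector) \<Rightarrow> 'm \<Rightarrow> real^'n \<Rightarrow> 'b" where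
  "dif K F p = frechet_derivative (F \<circ> inv_into (fst K) (snd K)) (at (snd K p))"

text \<open>
  \<open>g K p\<close> is the bilinear form of the metric at \<open>p\<close> in the coordinates of \<open>K\<close>; the last clause is
  the transformation rule under a change of chart.
\<close>

definition riemannian_metric ::
    "('m, 'n::finite) chart set \<Rightarrow> (('m, 'n) chart \<Rightarrow> 'm \<Rightarrow> real^'n \<Rightarrow> real^'n \<Rightarrow> real) \<Rightarrow> bool" where
  "riemannian_metric \<A> g \<longleftrightarrow>
     (\<forall>K\<in>\<A>. \<forall>p\<in>fst K. bilinear (g K p) \<and> (\<forall>u v. g K p u v = g K p v u) \<and>
        (\<forall>u. u \<noteq> 0 \<longrightarrow> g K p u u > 0)) \<and>
     (\<forall>K\<in>\<A>. \<forall>u v. smooth_on (snd K ` fst K) (\<lambda>x. g K (inv_into (fst K) (snd K) x) u v)) \<and>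
     (\<forall>K\<in>\<A>. \<forall>L\<in>\<A>. \<forall>p\<in>fst K \<inter> fst L. \<forall>u v.
        g K p u v = g L p (dif K (snd L) p u) (dif K (snd L) p v))"


text \<open>
  The ambient space \<open>\<bbbQ>\<^sup>n\<^sub>c \<times> \<real>\<close> as a submanifold of \<open>(\<real>\<^sup>n \<times> \<real>) \<times> \<real>\<close> with the flat form
  \<open>|dx|\<^sup>2 + c ds\<^sup>2 + dt\<^sup>2\<close>: for \<open>c = 1\<close> the round unit sphere, for \<open>c = -1\<close> the upper sheet of the
  hyperboloid in Lorentz space.
\<close>

type_synonym 'n ambient = "((real^'n) \<times> real) \<times> real"

definition qinner :: "real \<Rightarrow> 'n::finite ambient \<Rightarrow> 'n ambient \<Rightarrow> real" where
  "qinner c v w = fst (fst v) \<bullet> fst (fst w) + c * snd (fst v) * snd (fst w) + snd v * snd w"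

definition QR :: "real \<Rightarrow> 'n::finite ambient set" where
  "QR c = {x. qinner c (fst x, 0) (fst x, 0) = c \<and> (c = -1 \<longrightarrow> snd (fst x) > 0)}"

text \<open>
  The normal space of \<open>QR c\<close> at \<open>x\<close> is spanned by \<open>(fst x, 0)\<close>, whose square norm is \<open>c = 1/c\<close>.
\<close>

definition QR_tangent :: "real \<Rightarrow> 'n::finite ambient \<Rightarrow> 'n ambient set" where
  "QR_tangent c x = {v. qinner c v (fst x, 0) = 0}"

definition tan_proj :: "real \<Rightarrow> 'n::finite ambient \<Rightarrow> 'n ambient \<Rightarrow> 'n ambient" where
  "tan_proj c x w = w - (c * qinner c w (fst x, 0)) *\<^sub>R (fst x, 0)"

text \<open>
  The Levi-Civita connection of \<open>QR c\<close> is the tangential part of the flat derivative.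
\<close>

definition geodesic :: "real \<Rightarrow> (real \<Rightarrow> 'n::finite ambient) \<Rightarrow> bool" where
  "geodesic c \<gamma> \<longleftrightarrow> range \<gamma> \<subseteq> QR c \<and>
     (\<exists>\<gamma>' \<gamma>''. \<forall>s. (\<gamma> has_vector_derivative \<gamma>' s) (at s) \<and>
        (\<gamma>' has_vector_derivative \<gamma>'' s) (at s) \<and> tan_proj c (\<gamma> s) (\<gamma>'' s) = 0)"

definition QR_exp :: "real \<Rightarrow> 'n::finite ambient \<Rightarrow> 'n ambient \<Rightarrow> 'n ambient" where
  "QR_exp c x v =
     (THE y. \<exists>\<gamma>. geodesic c \<gamma> \<and> \<gamma> 0 = x \<and> (\<gamma> has_vector_derivative v) (at 0) \<and> \<gamma> 1 = y)"

definition d_dt :: "'n::finite ambient" where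
  "d_dt = ((0, 0), 1)"


text \<open>
  \<open>f\<close>, restricted to the connected open set \<open>W\<close>, is an immersed hypersurface with smooth unit
  normal field \<open>\<eta>\<close>.
\<close>

definition hypersurface ::
    "real \<Rightarrow> 'm topology \<Rightarrow> ('m, 'n::finite) chart set \<Rightarrow> 'm set \<Rightarrow>
     ('m \<Rightarrow> 'n ambient) \<Rightarrow> ('m \<Rightarrow> 'n ambient) \<Rightarrow> bool" where
  "hypersurface c X \<A> W f \<eta> \<longleftrightarrow>
     openin X W \<and> connectedin X W \<and>
     smooth_map_on \<A> W f \<and> f ` W \<subseteq> QR c \<and> (\<forall>K\<in>\<A>. \<forall>p\<in>fst K \<inter> W. inj (dif K f p)) \<and>
     smooth_map_on \<A> W \<eta> \<and>
     (\<forall>p\<in>W. \<eta> p \<in> QR_tangent c (f p) \<and> qinner c (\<eta> p) (\<eta> p) = 1) \<and>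
     (\<forall>K\<in>\<A>. \<forall>p\<in>fst K \<inter> W. \<forall>v. qinner c (\<eta> p) (dif K f p v) = 0)"

definition isometric ::
    "real \<Rightarrow> ('m, 'n::finite) chart set \<Rightarrow> (('m, 'n) chart \<Rightarrow> 'm \<Rightarrow> real^'n \<Rightarrow> real^'n \<Rightarrow> real) \<Rightarrow>
     ('m \<Rightarrow> 'n ambient) \<Rightarrow> bool" where
  "isometric c \<A> g f \<longleftrightarrow>
     (\<forall>K\<in>\<A>. \<forall>p\<in>fst K. \<forall>u v. qinner c (dif K f p u) (dif K f p v) = g K p u v)"

text \<open>The shape operator, \<open>df (A v) = - \<nabla>\<^sub>v \<eta>\<close>, in the coordinates of \<open>K\<close>.\<close>

definition shape_op ::
    "real \<Rightarrow> ('m, 'n::finite) chart \<Rightarrow> ('m \<Rightarrow> 'n ambient) \<Rightarrow> ('m \<Rightarrow> 'n ambient) \<Rightarrow> 'm \<Rightarrow>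
     real^'n \<Rightarrow> real^'n" where
  "shape_op c K f \<eta> p v = (THE w. dif K f p w = - tan_proj c (f p) (dif K \<eta> p v))"

definition mean_curvature ::
    "real \<Rightarrow> ('m, 'n::finite) chart \<Rightarrow> ('m \<Rightarrow> 'n ambient) \<Rightarrow> ('m \<Rightarrow> 'n ambient) \<Rightarrow> 'm \<Rightarrow> real" where
  "mean_curvature c K f \<eta> p = trace (matrix (shape_op c K f \<eta> p)) / real CARD('n)"

definition constant_mean_curvature ::
    "real \<Rightarrow> ('m, 'n::finite) chart set \<Rightarrow> 'm set \<Rightarrow> ('m \<Rightarrow> 'n ambient) \<Rightarrow> ('m \<Rightarrow> 'n ambient) \<Rightarrow> bool"
  where
  "constant_mean_curvature c \<A> W f \<eta> \<longleftrightarrow>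
     (\<exists>h. \<forall>K\<in>\<A>. \<forall>p\<in>fst K \<inter> W. mean_curvature c K f \<eta> p = h)"

text \<open>
  Multiplicity of \<open>r\<close> as a principal curvature at \<open>p\<close>; it is \<open>0\<close> if \<open>r\<close> is not an eigenvalue of the
  shape operator. Geometric and algebraic multiplicity agree since the shape operator is self-adjoint.
\<close>

definition principal_multiplicity ::
    "real \<Rightarrow> ('m, 'n::finite) chart \<Rightarrow> ('m \<Rightarrow> 'n ambient) \<Rightarrow> ('m \<Rightarrow> 'n ambient) \<Rightarrow> 'm \<Rightarrow> real \<Rightarrow> nat"
  where
  "principal_multiplicity c K f \<eta> p r = dim {v. shape_op c K f \<eta> p v = r *\<^sub>R v}"

definition constant_principal_curvatures ::
    "real \<Rightarrow> ('m, 'n::finite) chart set \<Rightarrow> ('m \<Rightarrow> 'n ambient) \<Rightarrow> ('m \<Rightarrow> 'n ambient) \<Rightarrow> bool" where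
  "constant_principal_curvatures c \<A> f \<eta> \<longleftrightarrow>
     (\<exists>m. \<forall>K\<in>\<A>. \<forall>p\<in>fst K. \<forall>r. principal_multiplicity c K f \<eta> p r = m r)"

definition parallel_map ::
    "real \<Rightarrow> ('m \<Rightarrow> 'n::finite ambient) \<Rightarrow> ('m \<Rightarrow> 'n ambient) \<Rightarrow> real \<Rightarrow> 'm \<Rightarrow> 'n ambient" where
  "parallel_map c f \<eta> t p = QR_exp c (f p) (t *\<^sub>R \<eta> p)"

text \<open>
  Every point has a neighbourhood \<open>W\<close> on which the nearby parallel hypersurfaces have constant
  mean curvature. The choice of unit normal \<open>\<xi>\<close> of \<open>f\<^sub>t\<close> is immaterial: on the
  connected set \<open>W\<close> it only affects the sign of the mean curvature.
\<close>

definition isoparametric ::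
    "real \<Rightarrow> 'm topology \<Rightarrow> ('m, 'n::finite) chart set \<Rightarrow>
     ('m \<Rightarrow> 'n ambient) \<Rightarrow> ('m \<Rightarrow> 'n ambient) \<Rightarrow> bool" where
  "isoparametric c X \<A> f \<eta> \<longleftrightarrow>
     (\<forall>p\<in>topspace X. \<exists>W \<epsilon>. p \<in> W \<and> \<epsilon> > 0 \<and>
        (\<forall>t. \<bar>t\<bar> < \<epsilon> \<longrightarrow>
           (\<exists>\<xi>. hypersurface c X \<A> W (parallel_map c f \<eta> t) \<xi> \<and>
                constant_mean_curvature c \<A> W (parallel_map c f \<eta> t) \<xi>)))"

text \<open>The tangent field \<open>T\<close> of the decomposition \<open>\<partial>/\<partial>t = df T + \<nu> \<eta>\<close>, in the coordinates of \<open>K\<close>.\<close>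

definition T_field ::
    "('m, 'n::finite) chart \<Rightarrow> ('m \<Rightarrow> 'n ambient) \<Rightarrow> ('m \<Rightarrow> 'n ambient) \<Rightarrow> 'm \<Rightarrow> real^'n" where
  "T_field K f \<eta> p = (THE v. \<exists>\<nu>. d_dt = dif K f p v + \<nu> *\<^sub>R \<eta> p)"

definition T_principal_direction ::
    "real \<Rightarrow> ('m, 'n::finite) chart set \<Rightarrow> ('m \<Rightarrow> 'n ambient) \<Rightarrow> ('m \<Rightarrow> 'n ambient) \<Rightarrow> bool" where
  "T_principal_direction c \<A> f \<eta> \<longleftrightarrow>
     (\<forall>K\<in>\<A>. \<forall>p\<in>fst K. T_field K f \<eta> p \<noteq> 0 \<and>
        (\<exists>r. shape_op c K f \<eta> p (T_field K f \<eta> p) = r *\<^sub>R T_field K f \<eta> p))"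

definition T_norm ::
    "(('m, 'n::finite) chart \<Rightarrow> 'm \<Rightarrow> real^'n \<Rightarrow> real^'n \<Rightarrow> real) \<Rightarrow> ('m, 'n) chart \<Rightarrow>
     ('m \<Rightarrow> 'n ambient) \<Rightarrow> ('m \<Rightarrow> 'n ambient) \<Rightarrow> 'm \<Rightarrow> real" where
  "T_norm g K f \<eta> p = sqrt (g K p (T_field K f \<eta> p) (T_field K f \<eta> p))"

end

theory Submission
  imports Defs
begin

text \<open>
  Write \<open>\<tau> = \<parallel>T\<parallel>\<close>, \<open>A T = \<lambda> T\<close>, and let \<open>C\<close>, \<open>S\<close> solve \<open>y'' = - c \<tau>\<^sup>2 y\<close> with initial values
  \<open>(1, 0)\<close> and \<open>(0, 1)\<close>. Since \<open>T\<close> is principal, the shape operator commutes with the Jacobi operator of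
  the normal direction, which is \<open>0\<close> on \<open>T\<close> and \<open>c \<tau>\<^sup>2\<close> on \<open>T\<^sup>\<bottom>\<close>. Hence the parallel hypersurface at
  distance \<open>t\<close> has the principal curvatures \<open>\<lambda> / (1 - t \<lambda>)\<close> and
  \<open>(\<mu> C + c \<tau>\<^sup>2 S) / (C - \<mu> S)\<close>, one for each principal curvature \<open>\<mu>\<close> of \<open>f\<close> on \<open>T\<^sup>\<bottom>\<close>, and their sum
  depends on \<open>t\<close> only. Its derivative at \<open>t = 0\<close> is \<open>tr A\<^sup>2 + (n - 1) c \<tau>\<^sup>2\<close>, so constant
  principal curvatures force \<open>\<tau>\<close> to be constant. Conversely, if \<open>\<tau>\<close> is constant then so is \<open>\<nu>\<close>, and
  \<open>d\<nu>(T) = - \<lambda> \<tau>\<^sup>2\<close> gives \<open>\<lambda> = 0\<close>; the remaining sum is minus the logarithmic derivative of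
  \<open>\<Prod>(C - \<mu> S)\<close>, and this product, as a function of \<open>C/S\<close>, determines the characteristic
  polynomial of \<open>A\<close>.
\<close>

section \<open>Symmetry of the second derivative\<close>

lemma mvt_unit:
  fixes \<phi> \<phi>' :: "real \<Rightarrow> real"
  assumes "s > 0" and "\<And>r. 0 \<le> r \<Longrightarrow> r \<le> s \<Longrightarrow> (\<phi> has_real_derivative \<phi>' r) (at r)"
  obtains r where "0 < r" "r < s" "\<phi> s - \<phi> 0 = s * \<phi>' r"
  using MVT2[of 0 s \<phi> \<phi>'] assms by auto

text \<open>The mean value theorem is applied twice: along \<open>u\<close> to the difference of two
  translates of \<open>F\<close>, then along \<open>v\<close> to the derivative in direction
  \<open>u\<close>. Exchanging \<open>u\<close> and \<open>v\<close> leaves the second difference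
  unchanged but produces the other mixed derivative.\<close>

lemma second_difference_mvt:
  fixes F :: "'a::real_normed_vector \<Rightarrow> real"
  assumes s: "s > 0"
    and dF: "\<And>y. y \<in> S \<Longrightarrow> (F has_derivative DF y) (at y)"
    and da: "\<And>y. y \<in> S \<Longrightarrow> ((\<lambda>z. DF z u) has_derivative Da y) (at y)"
    and S: "\<And>r q. 0 \<le> r \<Longrightarrow> r \<le> s \<Longrightarrow> 0 \<le> q \<Longrightarrow> q \<le> s \<Longrightarrow> x + r *\<^sub>R u + q *\<^sub>R v \<in> S"
  obtains r q where "0 < r" "r < s" "0 < q" "q < s"
    "F (x + s *\<^sub>R u + s *\<^sub>R v) - F (x + s *\<^sub>R u) - (F (x + s *\<^sub>R v) - F x)
      = s * s * Da (x + r *\<^sub>R u + q *\<^sub>R v) v"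
proof -
  have chain: "((\<lambda>r. F (x + r *\<^sub>R u + q *\<^sub>R v)) has_real_derivative DF (x + r *\<^sub>R u + q *\<^sub>R v) u) (at r)"
    if "0 \<le> r" "r \<le> s" "0 \<le> q" "q \<le> s" for r q
  proof -
    have "((\<lambda>r. F (x + r *\<^sub>R u + q *\<^sub>R v)) has_derivative (\<lambda>h. DF (x + r *\<^sub>R u + q *\<^sub>R v) (h *\<^sub>R u))) (at r)"
      by (rule has_derivative_compose[where f="\<lambda>r. x + r *\<^sub>R u + q *\<^sub>R v" and g=F])
        (auto intro!: derivative_eq_intros dF S that)
    moreover have "DF (x + r *\<^sub>R u + q *\<^sub>R v) (h *\<^sub>R u) = h * DF (x + r *\<^sub>R u + q *\<^sub>R v) u" for h
      using linear_scale[OF has_derivative_linear[OF dF[OF S[OF that]]]] by simp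
    ultimately show ?thesis by (simp add: has_field_derivative_def mult_commute_abs)
  qed
  have "((\<lambda>r. F (x + r *\<^sub>R u + s *\<^sub>R v) - F (x + r *\<^sub>R u)) has_real_derivative
      DF (x + r *\<^sub>R u + s *\<^sub>R v) u - DF (x + r *\<^sub>R u) u) (at r)" if "0 \<le> r" "r \<le> s" for r
    using DERIV_diff[OF chain[of r s] chain[of r 0]] that s by simp
  then obtain r where r: "0 < r" "r < s" and
    e: "F (x + s *\<^sub>R u + s *\<^sub>R v) - F (x + s *\<^sub>R u) - (F (x + s *\<^sub>R v) - F x)
      = s * (DF (x + r *\<^sub>R u + s *\<^sub>R v) u - DF (x + r *\<^sub>R u) u)"
    using mvt_unit[OF s, of "\<lambda>r. F (x + r *\<^sub>R u + s *\<^sub>R v) - F (x + r *\<^sub>R u)"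
       "\<lambda>r. DF (x + r *\<^sub>R u + s *\<^sub>R v) u - DF (x + r *\<^sub>R u) u"] by auto
  have chain2: "((\<lambda>q. DF (x + r *\<^sub>R u + q *\<^sub>R v) u) has_real_derivative Da (x + r *\<^sub>R u + q *\<^sub>R v) v) (at q)"
    if "0 \<le> q" "q \<le> s" for q
  proof -
    have xS: "x + r *\<^sub>R u + q *\<^sub>R v \<in> S" using S that r by simp
    have "((\<lambda>q. DF (x + r *\<^sub>R u + q *\<^sub>R v) u) has_derivative (\<lambda>h. Da (x + r *\<^sub>R u + q *\<^sub>R v) (h *\<^sub>R v))) (at q)"
      by (rule has_derivative_compose[where f="\<lambda>q. x + r *\<^sub>R u + q *\<^sub>R v" and g="\<lambda>z. DF z u"])
        (auto intro!: derivative_eq_intros da xS)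
    moreover have "Da (x + r *\<^sub>R u + q *\<^sub>R v) (h *\<^sub>R v) = h * Da (x + r *\<^sub>R u + q *\<^sub>R v) v" for h
      using linear_scale[OF has_derivative_linear[OF da[OF xS]]] by simp
    ultimately show ?thesis by (simp add: has_field_derivative_def mult_commute_abs)
  qed
  obtain q where "0 < q" "q < s" 
    "DF (x + r *\<^sub>R u + s *\<^sub>R v) u - DF (x + r *\<^sub>R u) u = s * Da (x + r *\<^sub>R u + q *\<^sub>R v) v"
    using mvt_unit[OF s, of "\<lambda>q. DF (x + r *\<^sub>R u + q *\<^sub>R v) u" "\<lambda>q. Da (x + r *\<^sub>R u + q *\<^sub>R v) v"] chain2
    by auto
  with e r show ?thesis by (intro that[of r q]) simp_all
qed

text \<open>One small second difference, evaluated in both orders, is \<open>s * s\<close> times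
  either mixed derivative at points near \<open>x\<close>. Continuity brings both within half of
  their supposed gap of the values at \<open>x\<close>, a contradiction.\<close>

lemma symmetric_second_derivative_real:
  fixes F :: "'a::real_normed_vector \<Rightarrow> real"
  assumes "open S" "x \<in> S"
    and dF: "\<And>y. y \<in> S \<Longrightarrow> (F has_derivative DF y) (at y)"
    and da: "\<And>y w. y \<in> S \<Longrightarrow> ((\<lambda>z. DF z w) has_derivative D2 w y) (at y)"
    and cont: "\<And>w w'. continuous_on S (\<lambda>y. D2 w y w')"
  shows "D2 u x v = D2 v x u"
proof (rule ccontr)
  assume ne: "D2 u x v \<noteq> D2 v x u"
  define e where "e = \<bar>D2 u x v - D2 v x u\<bar> / 2"
  have e: "e > 0" using ne by (simp add: e_def)
  from \<open>open S\<close> \<open>x \<in> S\<close> obtain d0 where d0: "d0 > 0" "ball x d0 \<subseteq> S"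
    by (meson open_contains_ball)
  obtain d where d: "d > 0" "ball x d \<subseteq> S"
      "\<And>y. dist y x < d \<Longrightarrow> \<bar>D2 u y v - D2 u x v\<bar> < e"
      "\<And>y. dist y x < d \<Longrightarrow> \<bar>D2 v y u - D2 v x u\<bar> < e"
  proof -
    obtain d1 where d1: "d1 > 0" "\<And>y. y \<in> S \<Longrightarrow> dist y x < d1 \<Longrightarrow> \<bar>D2 u y v - D2 u x v\<bar> < e"
      using cont[of u v] \<open>x \<in> S\<close> e unfolding continuous_on_iff dist_real_def by meson
    obtain d2 where d2: "d2 > 0" "\<And>y. y \<in> S \<Longrightarrow> dist y x < d2 \<Longrightarrow> \<bar>D2 v y u - D2 v x u\<bar> < e"
      using cont[of v u] \<open>x \<in> S\<close> e unfolding continuous_on_iff dist_real_def by meson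
    have sub: "y \<in> S" if "dist y x < min d0 (min d1 d2)" for y
      using d0 that by (auto simp: subset_iff dist_commute)
    show ?thesis
      by (rule that[of "min d0 (min d1 d2)"]) (use d0 d1 d2 sub in \<open>auto simp: dist_commute\<close>)
  qed
  \<comment> \<open>Small enough that the whole parallelogram spanned by \<open>s u\<close> and
    \<open>s v\<close> at \<open>x\<close> stays within distance \<open>d\<close>; the
    \<open>+ 1\<close> avoids division by zero when \<open>u = v = 0\<close>.\<close>
  define s where "s = d / (2 * (norm u + norm v + 1))"
  have s: "s > 0" using d(1) by (simp add: s_def add_nonneg_pos)
  have near: "dist (x + r *\<^sub>R u + q *\<^sub>R v) x < d" if "0 \<le> r" "r \<le> s" "0 \<le> q" "q \<le> s" for r q
  proof -
    have "dist (x + r *\<^sub>R u + q *\<^sub>R v) x \<le> r * norm u + q * norm v"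
      using norm_triangle_ineq[of "r *\<^sub>R u" "q *\<^sub>R v"] that by (simp add: dist_norm add.assoc)
    also have "\<dots> \<le> s * norm u + s * norm v"
      by (intro add_mono mult_right_mono that) auto
    also have "\<dots> < s * (2 * (norm u + norm v + 1))"
      using s by (simp add: algebra_simps add_pos_nonneg)
        (smt (verit) mult_nonneg_nonneg norm_ge_zero)
    also have "\<dots> = d"
    proof -
      have "2 * (norm u + norm v + 1) > 0"
        by (simp add: add_nonneg_pos)
      then show ?thesis by (simp add: s_def)
    qed
    finally show ?thesis .
  qed
  have near': "dist (x + r *\<^sub>R v + q *\<^sub>R u) x < d" if "0 \<le> r" "r \<le> s" "0 \<le> q" "q \<le> s" for r q
    using near[of q r] that by (simp add: add.assoc add.commute[of "r *\<^sub>R v"])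
  have inS: "y \<in> S" if "dist y x < d" for y
    using d(2) that by (auto simp: dist_commute)
  obtain r q where 1: "0 < r" "r < s" "0 < q" "q < s"
    "F (x + s *\<^sub>R u + s *\<^sub>R v) - F (x + s *\<^sub>R u) - (F (x + s *\<^sub>R v) - F x)
      = s * s * D2 u (x + r *\<^sub>R u + q *\<^sub>R v) v"
    using second_difference_mvt[OF s dF da[of _ u] inS[OF near]] by blast
  obtain r' q' where 2: "0 < r'" "r' < s" "0 < q'" "q' < s"
    "F (x + s *\<^sub>R v + s *\<^sub>R u) - F (x + s *\<^sub>R v) - (F (x + s *\<^sub>R u) - F x)
      = s * s * D2 v (x + r' *\<^sub>R v + q' *\<^sub>R u) u"
    using second_difference_mvt[OF s dF da[of _ v] inS[OF near']] by blast
  have "x + s *\<^sub>R v + s *\<^sub>R u = x + s *\<^sub>R u + s *\<^sub>R v" by simp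
  with 2(5) have "F (x + s *\<^sub>R u + s *\<^sub>R v) - F (x + s *\<^sub>R v) - (F (x + s *\<^sub>R u) - F x)
      = s * s * D2 v (x + r' *\<^sub>R v + q' *\<^sub>R u) u" by simp
  \<comment> \<open>The two orders differ only in which of the two middle values is subtracted
    first.\<close>
  moreover have "e = e'" if "a - b - (c - d) = e" "a - c - (b - d) = e'" for a b c d e e' :: real
    using that by simp
  ultimately have "s * s * D2 u (x + r *\<^sub>R u + q *\<^sub>R v) v = s * s * D2 v (x + r' *\<^sub>R v + q' *\<^sub>R u) u"
    using 1(5) by blast
  then have "D2 u (x + r *\<^sub>R u + q *\<^sub>R v) v = D2 v (x + r' *\<^sub>R v + q' *\<^sub>R u) u"
    using s by simp
  moreover have "\<bar>D2 u (x + r *\<^sub>R u + q *\<^sub>R v) v - D2 u x v\<bar> < e" 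
    using d(3) near 1 by simp
  moreover have "\<bar>D2 v (x + r' *\<^sub>R v + q' *\<^sub>R u) u - D2 v x u\<bar> < e" 
    using d(4) near' 2 by simp
  ultimately show False unfolding e_def by argo
qed

lemma frechet_derivative_inner:
  assumes "F differentiable (at x)"
  shows "((\<lambda>z. F z \<bullet> e) has_derivative (\<lambda>v. frechet_derivative F (at x) v \<bullet> e)) (at x)"
  using assms by (auto intro!: derivative_eq_intros simp: frechet_derivative_works[symmetric])

text \<open>Pairing with an arbitrary vector \<open>e\<close> reduces this to the real-valued
  case.\<close>

lemma smooth_on_imp_second_derivative_symmetric:
  fixes F :: "'a::euclidean_space \<Rightarrow> 'b::euclidean_space"
  assumes "smooth_on S F" "open S" "x \<in> S"
  shows "frechet_derivative (\<lambda>y. frechet_derivative F (at y) u) (at x) v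
       = frechet_derivative (\<lambda>y. frechet_derivative F (at y) v) (at x) u"
proof -
  have c: "Ck_on (Suc (Suc 0)) S F" using assms(1) unfolding smooth_on_def by blast
  have "frechet_derivative (\<lambda>y. frechet_derivative F (at y) u) (at x) v \<bullet> e
       = frechet_derivative (\<lambda>y. frechet_derivative F (at y) v) (at x) u \<bullet> e" for e
    by (rule symmetric_second_derivative_real[OF assms(2,3), where F="\<lambda>z. F z \<bullet> e"
      and DF="\<lambda>y v. frechet_derivative F (at y) v \<bullet> e"
      and ?D2.0="\<lambda>w y v. frechet_derivative (\<lambda>y. frechet_derivative F (at y) w) (at y) v \<bullet> e"])
     (use c in \<open>auto intro!: frechet_derivative_inner continuous_intros\<close>)
  then show ?thesis using vector_eq_rdot by blast
qed

section \<open>Self-adjoint operators with respect to an inner product\<close>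

locale symmetric_form =
  fixes G :: "'a::euclidean_space \<Rightarrow> 'a \<Rightarrow> real"
  assumes bil: "bilinear G"
    and sym: "G u v = G v u"
    and pos: "u \<noteq> 0 \<Longrightarrow> G u u > 0"
begin

lemma form_simps:
  "G (u + v) w = G u w + G v w" "G w (u + v) = G w u + G w v"
  "G (u - v) w = G u w - G v w" "G w (u - v) = G w u - G w v"
  "G (r *\<^sub>R u) w = r * G u w" "G w (r *\<^sub>R u) = r * G w u"
  "G 0 w = 0" "G w 0 = 0"
  "G (sum h B) w = (\<Sum>b\<in>B. G (h b) w)"
  using bilinear_ladd[OF bil] bilinear_radd[OF bil] bilinear_lsub[OF bil] bilinear_rsub[OF bil]
    bilinear_lmul[OF bil] bilinear_rmul[OF bil] bilinear_lzero[OF bil] bilinear_rzero[OF bil]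
    linear_sum[of "\<lambda>u. G u w"] bil by (auto simp: bilinear_def)

lemma zero_iff: "G u u = 0 \<longleftrightarrow> u = 0"
  using pos[of u] form_simps(7) by force

lemma continuous [continuous_intros]:
  "continuous_on S a \<Longrightarrow> continuous_on S b \<Longrightarrow> continuous_on S (\<lambda>x. G (a x) (b x))"
  using bil unfolding bilinear_conv_bounded_bilinear by (rule bounded_bilinear.continuous_on)

text \<open>A maximum point of the Rayleigh quotient on \<open>S\<close> is an eigenvector.\<close>

lemma exists_eigenvector:
  assumes S: "subspace S" "S \<noteq> {0}"
    and A: "linear A" "\<And>u. u \<in> S \<Longrightarrow> A u \<in> S" "\<And>u v. G (A u) v = G u (A v)"
  obtains v r where "v \<in> S" "v \<noteq> 0" "A v = r *\<^sub>R v"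
proof -
  let ?C = "S \<inter> sphere 0 1"
  let ?q = "\<lambda>v. G (A v) v / G v v"
  note Asimps = linear_add[OF A(1)] linear_scale[OF A(1)] linear_diff[OF A(1)]
  have lin: "continuous_on ?C A" using A(1) by (simp add: linear_continuous_on linear_conv_bounded_linear)
  have "compact ?C"
    using closed_subspace[OF S(1)] by (simp add: closed_Int_compact)
  moreover have "?C \<noteq> {}"
  proof -
    obtain w where w: "w \<in> S" "w \<noteq> 0" using S subspace_0[OF S(1)] by auto
    then have "(1 / norm w) *\<^sub>R w \<in> ?C" using subspace_scale[OF S(1)] by auto
    then show ?thesis by blast
  qed
  moreover have "continuous_on ?C ?q"
    using lin by (intro continuous_intros) (auto simp: zero_iff)
  ultimately have "\<exists>v\<in>?C. \<forall>w\<in>?C. ?q w \<le> ?q v"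
    by (rule continuous_attains_sup)
  then obtain v where v: "v \<in> ?C" and max: "\<And>w. w \<in> ?C \<Longrightarrow> ?q w \<le> ?q v"
    by metis
  then have vS: "v \<in> S" "v \<noteq> 0" by auto
  define r where "r = ?q v"
  \<comment> \<open>By maximality of \<open>r\<close> this form is nonnegative on \<open>S\<close>,
    and it vanishes at \<open>v\<close>; such a form must annihilate \<open>v\<close> against all of
    \<open>S\<close>.\<close>
  let ?H = "\<lambda>u w. r * G u w - G (A u) w"
  have H0: "?H v v = 0" using pos[OF vS(2)] by (simp add: r_def)
  have Hpos: "?H w w \<ge> 0" if "w \<in> S" for w
  proof (cases "w = 0")
    case False
    let ?w = "(1 / norm w) *\<^sub>R w"
    have "?w \<in> ?C" using that False subspace_scale[OF S(1)] by auto
    from max[OF this] have "?q ?w \<le> r" by (simp add: r_def)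
    moreover have "?q ?w = ?q w" using False by (simp add: form_simps Asimps)
    ultimately show ?thesis using pos[OF False] by (simp add: divide_simps)
  qed (simp add: form_simps)
  have H: "?H v u = 0" if "u \<in> S" for u
  proof (rule ccontr)
    assume ne: "?H v u \<noteq> 0"
    have sym': "G (A u) v = G (A v) u" using A(3)[of u v] sym[of u "A v"] by simp
    have exp: "?H (v + s *\<^sub>R u) (v + s *\<^sub>R u) = 2 * s * ?H v u + s * s * ?H u u" for s
      using H0 by (simp add: form_simps Asimps sym' sym[of u v] algebra_simps)
    have ge: "0 \<le> 2 * s * ?H v u + s * s * ?H u u" for s
      using Hpos[of "v + s *\<^sub>R u"] that vS S(1) unfolding exp by (simp add: subspace_add subspace_scale)
    define b where "b = ?H v u"
    define a where "a = ?H u u"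
    have a: "a \<ge> 0" using Hpos[OF that] by (simp add: a_def)
    \<comment> \<open>The quadratic in \<open>s\<close> is tested close to its minimum:
      \<open>a + 1\<close> instead of \<open>a\<close> keeps the denominator positive when
      \<open>a = 0\<close>, and the value is still negative for \<open>b \<noteq> 0\<close>.\<close>
    have "0 \<le> 2 * (- b / (a + 1)) * b + (- b / (a + 1)) * (- b / (a + 1)) * a"
      using ge[of "- b / (a + 1)"] by (simp add: a_def b_def)
    also have "\<dots> = - (b * b) * (a + 2) / ((a + 1) * (a + 1))"
      using a by (simp add: divide_simps) (simp add: algebra_simps)
    also have "\<dots> < 0" using ne a
      by (intro divide_neg_pos mult_neg_pos) (auto simp: b_def not_sum_squares_lt_zero zero_less_mult_iff)
    finally show False by simp
  qed
  \<comment> \<open>The residual itself serves as test vector, which makes its own square norm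
    zero.\<close>
  have "r *\<^sub>R v - A v \<in> S" using vS S(1) A(2) by (simp add: subspace_diff subspace_scale)
  from H[OF this] have "G (r *\<^sub>R v - A v) (r *\<^sub>R v - A v) = 0" by (simp add: form_simps algebra_simps)
  then have "A v = r *\<^sub>R v" by (simp add: zero_iff)
  with vS show ?thesis using that by blast
qed

lemma orthogonal_independent:
  assumes "0 \<notin> B" "\<And>b b'. b \<in> B \<Longrightarrow> b' \<in> B \<Longrightarrow> b \<noteq> b' \<Longrightarrow> G b b' = 0"
  shows "independent B"
  unfolding independent_explicit_module
proof (intro allI impI)
  fix t u w
  assume t: "finite t" "t \<subseteq> B" "(\<Sum>v\<in>t. u v *\<^sub>R v) = 0" and w: "w \<in> t"
  have "0 = G (\<Sum>v\<in>t. u v *\<^sub>R v) w" using t by (simp add: form_simps)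
  also have "\<dots> = (\<Sum>v\<in>t. if v = w then u w * G w w else 0)"
    unfolding form_simps using assms(2) t w by (intro sum.cong) (auto simp: subset_iff)
  also have "\<dots> = u w * G w w" using t w by simp
  finally show "u w = 0" using pos[of w] assms(1) t w by fastforce
qed

text \<open>Among orthogonal sets of eigenvectors containing \<open>T\<close>, one of maximal
  cardinality is taken. Its orthogonal complement is \<open>A\<close>-invariant by self-adjointness,
  so a nonzero complement would supply a further eigenvector.\<close>

lemma exists_orthogonal_eigenbasis:
  assumes A: "linear A" "\<And>u v. G (A u) v = G u (A v)"
    and T: "T \<noteq> 0" "A T = l *\<^sub>R T"
  obtains B where "finite B" "card B = DIM('a)" "T \<in> B" "0 \<notin> B"
    "\<And>b. b \<in> B \<Longrightarrow> \<exists>r. A b = r *\<^sub>R b"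
    "\<And>b b'. b \<in> B \<Longrightarrow> b' \<in> B \<Longrightarrow> b \<noteq> b' \<Longrightarrow> G b b' = 0"
proof -
  define P where "P B \<longleftrightarrow> finite B \<and> T \<in> B \<and> 0 \<notin> B \<and> (\<forall>b\<in>B. \<exists>r. A b = r *\<^sub>R b) \<and>
    (\<forall>b\<in>B. \<forall>b'\<in>B. b \<noteq> b' \<longrightarrow> G b b' = 0)" for B
  have ind: "independent B" if "P B" for B
    using that orthogonal_independent[of B] by (auto simp: P_def)
  have "P {T}" using T by (auto simp: P_def)
  moreover have "\<forall>B. P B \<longrightarrow> card B < Suc DIM('a)"
    using ind independent_bound by (meson less_Suc_eq_le)
  ultimately obtain B where B: "P B" and max: "\<And>B'. P B' \<Longrightarrow> card B' \<le> card B"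
    using ex_has_greatest_nat[of P "{T}" card "Suc DIM('a)"] by (metis less_imp_le)
  let ?S = "{u. \<forall>b\<in>B. G u b = 0}"
  have sub: "subspace ?S" by (auto simp: subspace_def form_simps)
  have inv: "A u \<in> ?S" if "u \<in> ?S" for u
  proof -
    have "G (A u) b = 0" if b: "b \<in> B" for b
    proof -
      obtain r where "A b = r *\<^sub>R b" using B b unfolding P_def by blast
      then show ?thesis using A(2) b \<open>u \<in> ?S\<close> by (simp add: form_simps)
    qed
    then show ?thesis by simp
  qed
  have "?S = {0}"
  proof (rule ccontr)
    assume "?S \<noteq> {0}"
    then obtain v r where v: "v \<in> ?S" "v \<noteq> 0" "A v = r *\<^sub>R v"
      using exists_eigenvector[OF sub _ A(1) inv A(2)] by blast
    then have "v \<notin> B" using pos[of v] by force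
    moreover have "P (insert v B)"
    proof -
      have "G b v = 0" "G v b = 0" if "b \<in> B" for b
        using that v(1) sym[of b v] by auto
      then show ?thesis using B v(2,3) unfolding P_def by auto
    qed
    ultimately show False using max[of "insert v B"] B by (simp add: P_def)
  qed
  have "v \<in> span B" for v
  proof -
    define p where "p = (\<Sum>b\<in>B. (G v b / G b b) *\<^sub>R b)"
    have "G (v - p) b = 0" if b: "b \<in> B" for b
    proof -
      have "G p b = (\<Sum>b'\<in>B. if b' = b then G v b else 0)"
        unfolding p_def form_simps using B b pos unfolding P_def
        by (intro sum.cong) (auto simp: zero_iff)
      then show ?thesis using B b by (simp add: form_simps P_def)
    qed
    then have "v - p \<in> ?S" by simp
    then have "v = p" using \<open>?S = {0}\<close> by simp
    then show ?thesis unfolding p_def using span_sum[of B "\<lambda>b. (G v b / G b b) *\<^sub>R b" B]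
      by (simp add: span_scale span_base)
  qed
  then have "card B = DIM('a)"
    using ind[OF B] basis_card_eq_dim[of B UNIV] by auto
  with B show ?thesis using that unfolding P_def by blast
qed

end

text \<open>Indexing by the dimension type turns traces and multiplicities into sums and
  cardinalities over \<open>UNIV\<close>; \<open>k\<close> marks the position of
  \<open>T\<close>.\<close>

lemma exists_indexed_eigenbasis:
  fixes G :: "real^'n \<Rightarrow> real^'n \<Rightarrow> real"
  assumes "symmetric_form G" and A: "linear A" "\<And>u v. G (A u) v = G u (A v)"
    and T: "T \<noteq> 0" "A T = l *\<^sub>R T"
  obtains b :: "'n \<Rightarrow> real^'n" and m k where "inj b" "independent (range b)" "span (range b) = UNIV"
    "b k = T" "m k = l" "\<And>i. A (b i) = m i *\<^sub>R b i" "\<And>i j. i \<noteq> j \<Longrightarrow> G (b i) (b j) = 0"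
proof -
  interpret symmetric_form G by fact
  obtain B where B: "finite B" "card B = DIM(real^'n)" "T \<in> B" "0 \<notin> B"
    "\<And>b. b \<in> B \<Longrightarrow> \<exists>r. A b = r *\<^sub>R b"
    "\<And>b b'. b \<in> B \<Longrightarrow> b' \<in> B \<Longrightarrow> b \<noteq> b' \<Longrightarrow> G b b' = 0"
    using exists_orthogonal_eigenbasis[OF A T] by blast
  have ind: "independent B" using orthogonal_independent B by blast
  have span: "span B = UNIV"
    using card_eq_dim[of B UNIV] B ind by auto
  obtain b :: "'n \<Rightarrow> real^'n" where b: "bij_betw b UNIV B"
    using finite_same_card_bij[of "UNIV::'n set" B] B by auto
  then have rb: "range b = B" "inj b" by (auto simp: bij_betw_def)
  have "\<forall>i. \<exists>r. A (b i) = r *\<^sub>R b i" using B(5) rb by blast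
  then obtain m where m: "\<And>i. A (b i) = m i *\<^sub>R b i" by metis
  obtain k where k: "b k = T" using rb B(3) by blast
  have "m k = l" using m[of k] T by (simp add: k)
  then show ?thesis
    by (intro that[of b k m]) (use rb ind span m k B(6) in \<open>auto simp: inj_eq\<close>)
qed

text \<open>Conjugation by the matrix \<open>P\<close> with columns \<open>b j\<close> makes
  \<open>L\<close> diagonal. Since \<open>P\<close> is square, spanning columns already make it
  invertible.\<close>

lemma trace_diagonal:
  fixes b :: "'n::finite \<Rightarrow> real^'n"
  assumes "linear L" "span (range b) = UNIV" "\<And>i. L (b i) = m i *\<^sub>R b i"
  shows "trace (matrix L) = sum m UNIV"
proof -
  define P :: "real^'n^'n" where "P = (\<chi> i j. b j $ i)"
  define D :: "real^'n^'n" where "D = (\<chi> i j. if i = j then m i else 0)"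
  have col: "column j P = b j" for j by (simp add: P_def column_def)
  have "columns P = range b" by (auto simp: columns_def col)
  then have "span (columns P) = UNIV" using assms(2) by simp
  then obtain R where R: "P ** R = mat 1"
    using matrix_right_invertible_span_columns[of P] by (auto simp: span_vec_eq)
  then have RP: "R ** P = mat 1" by (simp add: matrix_left_right_inverse)
  have "matrix L ** P = P ** D"
  proof -
    have "(matrix L ** P) $ i $ j = (P ** D) $ i $ j" for i j
    proof -
      have "(matrix L ** P) $ i $ j = (matrix L *v b j) $ i"
        by (simp add: matrix_matrix_mult_def matrix_vector_mult_def P_def)
      also have "\<dots> = m j * b j $ i"
        using assms(1,3) by (simp add: matrix_works)
      also have "\<dots> = (P ** D) $ i $ j"
        by (simp add: matrix_matrix_mult_def P_def D_def if_distrib cong: if_cong)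
      finally show ?thesis .
    qed
    then show ?thesis by (simp add: vec_eq_iff)
  qed
  then have "matrix L = P ** D ** R"
    using R by (metis matrix_mul_assoc matrix_mul_rid)
  then have "trace (matrix L) = trace (R ** (P ** D))"
    by (metis trace_mul_sym)
  also have "\<dots> = trace D" by (simp add: matrix_mul_assoc RP)
  finally show ?thesis by (simp add: trace_def D_def)
qed

text \<open>Comparing coefficients in the eigenbasis, an eigenvector for \<open>r\<close> has no
  component along \<open>b i\<close> unless \<open>m i = r\<close>.\<close>

lemma dim_eigenspace_diagonal:
  fixes b :: "'n::finite \<Rightarrow> 'a::euclidean_space"
  assumes "linear L" "inj b" "independent (range b)" "span (range b) = UNIV"
    "\<And>i. L (b i) = m i *\<^sub>R b i"
  shows "dim {v. L v = r *\<^sub>R v} = card {i. m i = r}"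
proof -
  have "{v. L v = r *\<^sub>R v} = span (b ` {i. m i = r})"
  proof
    show "span (b ` {i. m i = r}) \<subseteq> {v. L v = r *\<^sub>R v}"
    proof (rule span_minimal)
      show "subspace {v. L v = r *\<^sub>R v}"
        using assms(1) by (auto simp: subspace_def linear_add linear_scale linear_0 algebra_simps)
    qed (use assms(5) in auto)
    show "{v. L v = r *\<^sub>R v} \<subseteq> span (b ` {i. m i = r})"
    proof safe
      fix v assume v: "L v = r *\<^sub>R v"
      obtain a where a: "v = (\<Sum>i\<in>UNIV. a i *\<^sub>R b i)"
      proof -
        have "v \<in> span (range b)" using assms(4) by simp
        then obtain u where "v = (\<Sum>x\<in>range b. u x *\<^sub>R x)"
          using span_finite[of "range b"] by auto
        then show ?thesis using that[of "u \<circ> b"] assms(2) by (simp add: sum.reindex)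
      qed
      have "(\<Sum>i\<in>UNIV. (a i * (m i - r)) *\<^sub>R b i) = L v - r *\<^sub>R v"
        using assms(1,5) by (simp add: a linear_sum linear_scale scaleR_sum_right sum_subtractf
          algebra_simps)
      also have "\<dots> = 0" using v by simp
      finally have "(\<Sum>x\<in>range b. ((\<lambda>i. a i * (m i - r)) (inv b x)) *\<^sub>R x) = 0"
        using assms(2) by (simp add: sum.reindex)
      then have "\<forall>x\<in>range b. ((\<lambda>i. a i * (m i - r)) (inv b x)) = 0"
        using independentD[OF assms(3), of "range b" "\<lambda>x. (\<lambda>i. a i * (m i - r)) (inv b x)"]
        by simp
      then have z: "a i = 0" if "m i \<noteq> r" for i using assms(2) that by auto
      have "v = (\<Sum>i\<in>{i. m i = r}. a i *\<^sub>R b i)"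
        unfolding a using z by (intro sum.mono_neutral_right) auto
      then show "v \<in> span (b ` {i. m i = r})" by (auto intro!: span_sum intro: span_scale span_base)
    qed
  qed
  moreover have "independent (b ` {i. m i = r})"
    by (rule independent_mono[OF assms(3)]) auto
  ultimately have "dim {v. L v = r *\<^sub>R v} = card (b ` {i. m i = r})"
    by (simp add: dim_eq_card_independent)
  also have "\<dots> = card {i. m i = r}" using assms(2) by (intro card_image) (auto simp: inj_on_def inj_def)
  finally show ?thesis .
qed

text \<open>Polynomials that agree at infinitely many points are equal, and the cardinality is the
  order of \<open>r\<close> as a root.\<close>

lemma card_eq_of_prod_eq:
  fixes m m' :: "'i::finite \<Rightarrow> real"
  assumes "infinite Y" "\<And>y. y \<in> Y \<Longrightarrow> (\<Prod>i\<in>UNIV. y - m i) = (\<Prod>i\<in>UNIV. y - m' i)"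
  shows "card {i. m i = r} = card {i. m' i = r}"
proof -
  define P where "P m = (\<Prod>i\<in>UNIV. [:- m i, 1:])" for m :: "'i \<Rightarrow> real"
  have ord: "order r (P m) = card {i. m i = r}" for m :: "'i \<Rightarrow> real"
  proof -
    have "order r (\<Prod>i\<in>S. [:- m i, 1:]) = card {i\<in>S. m i = r}" for S :: "'i set"
    proof (induction S rule: infinite_finite_induct)
      case (insert x S)
      have "(\<Prod>i\<in>insert x S. [:- m i, 1:]) \<noteq> 0" using insert by (subst prod_zero_iff) auto
      then have "order r (\<Prod>i\<in>insert x S. [:- m i, 1:]) = order r [:- m x, 1:] + card {i\<in>S. m i = r}"
        using insert by (simp add: order_mult del: mult_pCons_left)
      moreover have "order r [:- m x, 1:] = (if m x = r then 1 else 0)"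
        using order_power_n_n[of r 1] by (auto intro: order_0I)
      moreover have "{i \<in> insert x S. m i = r} = (if m x = r then insert x {i\<in>S. m i = r} else {i\<in>S. m i = r})"
        by auto
      ultimately show ?case using insert by simp
    qed simp_all
    then show ?thesis by (simp add: P_def)
  qed
  have "P m - P m' = 0"
  proof (rule ccontr)
    assume "P m - P m' \<noteq> 0"
    then have "finite {y. poly (P m - P m') y = 0}" by (rule poly_roots_finite)
    moreover have "Y \<subseteq> {y. poly (P m - P m') y = 0}"
      using assms(2) by (auto simp: P_def poly_prod)
    ultimately show False using assms(1) finite_subset by blast
  qed
  then show ?thesis using ord[of m] ord[of m'] by simp
qed

text \<open>The neighbourhoods of points with value \<open>h p\<close> and those of points with
  another value form two open sets that would disconnect \<open>W\<close>.\<close>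

lemma connectedin_locally_constant:
  assumes "connectedin X W" "p \<in> W" "q \<in> W"
    and loc: "\<And>x. x \<in> W \<Longrightarrow> \<exists>V. openin X V \<and> x \<in> V \<and> (\<forall>y\<in>V \<inter> W. h y = h x)"
  shows "h p = h q"
proof (rule ccontr)
  assume ne: "h p \<noteq> h q"
  obtain V where V: "\<And>x. x \<in> W \<Longrightarrow> openin X (V x)" "\<And>x. x \<in> W \<Longrightarrow> x \<in> V x"
    "\<And>x y. x \<in> W \<Longrightarrow> y \<in> V x \<Longrightarrow> y \<in> W \<Longrightarrow> h y = h x"
    using loc by (metis IntI)
  let ?E = "\<Union>(V ` {x\<in>W. h x = h p})" and ?F = "\<Union>(V ` {x\<in>W. h x \<noteq> h p})"
  show False
  proof (rule connectedinD[OF assms(1)])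
    show "openin X ?E" "openin X ?F" using V(1) by (auto intro!: openin_Union)
    show "W \<subseteq> ?E \<union> ?F"
    proof
      fix x assume "x \<in> W"
      then show "x \<in> ?E \<union> ?F" using V(2)[of x] by (cases "h x = h p") blast+
    qed
    show "?E \<inter> ?F \<inter> W = {}"
    proof -
      have False if "y \<in> W" "x \<in> W" "h x = h p" "y \<in> V x" "z \<in> W" "h z \<noteq> h p" "y \<in> V z" for x y z
        using V(3)[of x y] V(3)[of z y] that by simp
      then show ?thesis by blast
    qed
    have "p \<in> ?E \<inter> W" using V(2)[OF assms(2)] assms(2) by blast
    then show "?E \<inter> W \<noteq> {}" by blast
    have "q \<in> ?F \<inter> W" using V(2)[OF assms(3)] assms(3) ne by auto
    then show "?F \<inter> W \<noteq> {}" by blast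
  qed
qed

section \<open>Geodesics of the ambient space\<close>

text \<open>The projection onto the linear space that contains the curved factor. The normal of
  \<open>QR c\<close> at \<open>x\<close> is \<open>Qpart x\<close>, so tangency and
  \<open>tan_proj\<close> depend on \<open>x\<close> only through it.\<close>

definition Qpart :: "'n::finite ambient \<Rightarrow> 'n ambient" where
  "Qpart v = (fst v, 0)"

lemma Qpart_simps [simp]:
  "fst (Qpart v) = fst v" "snd (Qpart v) = 0" "Qpart (Qpart v) = Qpart v"
  "Qpart (v + w) = Qpart v + Qpart w" "Qpart (v - w) = Qpart v - Qpart w"
  "Qpart (r *\<^sub>R v) = r *\<^sub>R Qpart v" "Qpart (- v) = - Qpart v" "Qpart 0 = 0" "Qpart d_dt = 0"
  by (auto simp: Qpart_def d_dt_def prod_eq_iff)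

lemma bounded_linear_Qpart: "bounded_linear Qpart"
  unfolding Qpart_def by (intro bounded_linear_Pair bounded_linear_fst bounded_linear_zero)

lemma Qpart_decomp: "v = Qpart v + snd v *\<^sub>R d_dt"
  by (simp add: Qpart_def d_dt_def prod_eq_iff)

lemma bilinear_qinner: "bilinear (qinner c)"
  unfolding bilinear_def qinner_def
  by (auto intro!: linearI simp: inner_add_left inner_add_right algebra_simps)

lemma bounded_bilinear_qinner: "bounded_bilinear (qinner c)"
  using bilinear_qinner bilinear_conv_bounded_bilinear by blast

lemmas has_derivative_qinner = bounded_bilinear.FDERIV[OF bounded_bilinear_qinner]
lemmas has_vector_derivative_qinner = bounded_bilinear.has_vector_derivative[OF bounded_bilinear_qinner]

lemma qinner_commute: "qinner c v w = qinner c w v"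
  by (simp add: qinner_def inner_commute)

lemma qinner_simps [simp]:
  "qinner c (u + v) w = qinner c u w + qinner c v w" "qinner c w (u + v) = qinner c w u + qinner c w v"
  "qinner c (u - v) w = qinner c u w - qinner c v w" "qinner c w (u - v) = qinner c w u - qinner c w v"
  "qinner c (r *\<^sub>R u) w = r * qinner c u w" "qinner c w (r *\<^sub>R u) = r * qinner c w u"
  "qinner c (- u) w = - qinner c u w" "qinner c w (- u) = - qinner c w u"
  "qinner c 0 w = 0" "qinner c w 0 = 0"
  "qinner c d_dt v = snd v" "qinner c v d_dt = snd v"
  by (simp_all add: qinner_def d_dt_def algebra_simps inner_add_left inner_add_right
      inner_diff_left inner_diff_right)

lemma qinner_Qpart: "qinner c (Qpart v) w = qinner c (Qpart v) (Qpart w)"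
    "qinner c v (Qpart w) = qinner c (Qpart v) (Qpart w)"
    "qinner c v w = qinner c (Qpart v) (Qpart w) + snd v * snd w"
  by (simp_all add: qinner_def Qpart_def)

lemma QR_alt: "x \<in> QR c \<longleftrightarrow> qinner c (Qpart x) (Qpart x) = c \<and> (c = -1 \<longrightarrow> snd (fst x) > 0)"
  by (simp add: QR_def Qpart_def)

lemma QR_tangent_alt: "v \<in> QR_tangent c x \<longleftrightarrow> qinner c v (Qpart x) = 0"
  by (simp add: QR_tangent_def Qpart_def)

lemma tan_proj_alt: "tan_proj c x w = w - (c * qinner c w (Qpart x)) *\<^sub>R Qpart x"
  by (simp add: tan_proj_def Qpart_def)

text \<open>For \<open>c = 1\<close> the form is Euclidean. For \<open>c = -1\<close> a vector
  orthogonal to a timelike vector is spacelike: Cauchy-Schwarz together with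
  \<open>q * q = 1 + b \<bullet> b\<close> bounds the negative term.\<close>

lemma qinner_tangent_pos:
  assumes "c \<in> {1, -1}" "x \<in> QR c" "v \<in> QR_tangent c x" "v \<noteq> 0"
  shows "qinner c v v > 0"
proof (cases "c = 1")
  case True
  obtain a s r where v: "v = ((a, s), r)" by (metis surj_pair)
  have "a \<bullet> a > 0 \<or> s * s > 0 \<or> r * r > 0"
    using assms(4) unfolding v by (auto simp: zero_prod_def zero_less_mult_iff)
  then show ?thesis
    using True inner_ge_zero[of a] zero_le_square[of s] zero_le_square[of r]
    unfolding v by (auto simp: qinner_def add_nonneg_pos add_pos_nonneg)
next
  case False
  then have c: "c = -1" using assms(1) by simp
  obtain a s r where v: "v = ((a, s), r)" by (metis surj_pair)
  obtain b q h where x: "x = ((b, q), h)" by (metis surj_pair)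
  have bq: "q * q = 1 + b \<bullet> b" "q > 0" and as: "a \<bullet> b = s * q"
    using assms(2,3) unfolding x v c by (auto simp: QR_def QR_tangent_def qinner_def)
  have cs: "(s * q) * (s * q) \<le> (a \<bullet> a) * (b \<bullet> b)"
    using Cauchy_Schwarz_ineq[of a b] by (simp add: as power2_eq_square)
  have s: "s * s * (q * q) \<le> (a \<bullet> a) * (q * q) - a \<bullet> a"
  proof -
    have "s * s * (q * q) = (s * q) * (s * q)" by (simp add: algebra_simps)
    moreover have "(a \<bullet> a) * (q * q) - a \<bullet> a = (a \<bullet> a) * (b \<bullet> b)"
      using bq(1) by (simp add: algebra_simps)
    ultimately show ?thesis using cs by (simp only:)
  qed
  show ?thesis
  proof (cases "a = 0")
    case True
    then have "s = 0" using as bq by simp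
    then have "r \<noteq> 0" using assms(4) True unfolding v by (simp add: zero_prod_def)
    then show ?thesis using True \<open>s = 0\<close> unfolding v c
      by (simp add: qinner_def zero_less_mult_iff) argo
  next
    case False
    then have "a \<bullet> a > 0" by simp
    then have "s * s * (q * q) < (a \<bullet> a) * (q * q)" using s by linarith
    then have "s * s < a \<bullet> a" using bq by (simp add: mult_less_cancel_right)
    then show ?thesis unfolding v c by (simp add: qinner_def add_pos_nonneg)
  qed
qed

text \<open>The solutions of \<open>y'' = - c \<tau>\<^sup>2 y\<close> with initial values \<open>(1, 0)\<close> and \<open>(0, 1)\<close>.\<close>

definition Cs :: "real \<Rightarrow> real \<Rightarrow> real \<Rightarrow> real" where
  "Cs c \<tau> t = (if c = 1 then cos (\<tau> * t) else cosh (\<tau> * t))"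

definition Sn :: "real \<Rightarrow> real \<Rightarrow> real \<Rightarrow> real" where
  "Sn c \<tau> t = (if \<tau> = 0 then t else if c = 1 then sin (\<tau> * t) / \<tau> else sinh (\<tau> * t) / \<tau>)"

context
  fixes c :: real
  assumes c: "c \<in> {1, -1}"
begin

lemma Cs_0 [simp]: "Cs c \<tau> 0 = 1" and Sn_0 [simp]: "Sn c \<tau> 0 = 0"
  by (auto simp: Cs_def Sn_def)

lemma Cs_Sn_squares: "Cs c \<tau> t * Cs c \<tau> t + c * \<tau>\<^sup>2 * (Sn c \<tau> t * Sn c \<tau> t) = 1"
  using c cosh_square_eq[of "\<tau> * t"] sin_cos_squared_add[of "\<tau> * t"]
  by (auto simp: Cs_def Sn_def power2_eq_square divide_simps)

lemma DERIV_Cs: "(Cs c \<tau> has_real_derivative - c * \<tau>\<^sup>2 * Sn c \<tau> t) (at t)"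
  using c unfolding Cs_def[abs_def] Sn_def
  by (auto intro!: derivative_eq_intros simp: power2_eq_square)

lemma DERIV_Sn: "(Sn c \<tau> has_real_derivative Cs c \<tau> t) (at t)"
  using c unfolding Cs_def Sn_def[abs_def]
  by (cases "\<tau> = 0"; cases "c = 1") (auto intro!: derivative_eq_intros)

text \<open>\<open>\<tau>\<close> varies over the hypersurface, so differentiating a parallel map
  also involves the derivative in this parameter.\<close>

lemma DERIV_Cs_param:
  "((\<lambda>\<tau>. Cs c \<tau> t) has_real_derivative - c * \<tau> * t * Sn c \<tau> t) (at \<tau>)"
  using c unfolding Cs_def[abs_def] Sn_def
  by (auto intro!: derivative_eq_intros)

lemma DERIV_Sn_param:
  assumes "\<tau> > 0"
  shows "((\<lambda>\<tau>. Sn c \<tau> t) has_real_derivative (t * Cs c \<tau> t - Sn c \<tau> t) / \<tau>) (at \<tau>)"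
proof -
  let ?h = "\<lambda>\<tau>. (if c = 1 then sin (\<tau> * t) else sinh (\<tau> * t)) / \<tau>"
  have "(?h has_real_derivative (t * Cs c \<tau> t - Sn c \<tau> t) / \<tau>) (at \<tau>)"
    using c assms unfolding Cs_def Sn_def
    by (auto intro!: derivative_eq_intros simp: field_simps)
  then have "(?h has_derivative (*) ((t * Cs c \<tau> t - Sn c \<tau> t) / \<tau>)) (at \<tau>)"
    by (simp add: has_field_derivative_def)
  \<comment> \<open>Around a positive \<open>\<tau>\<close> the separate case
    \<open>\<tau> = 0\<close> of \<open>Sn\<close> does not occur.\<close>
  then have "((\<lambda>\<tau>. Sn c \<tau> t) has_derivative (*) ((t * Cs c \<tau> t - Sn c \<tau> t) / \<tau>)) (at \<tau>)"
    by (rule has_derivative_transform_within_open[where s="{0<..}"])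
      (use assms in \<open>auto simp: Sn_def\<close>)
  then show ?thesis by (simp add: has_field_derivative_def)
qed

text \<open>Running for unit time with speed \<open>t * \<tau>\<close> amounts to running for time
  \<open>t\<close> with speed \<open>\<tau>\<close>; this rewrites the exponential of
  \<open>t \<eta>\<close>.\<close>

lemma Cs_scale: "Cs c (t * \<tau>) 1 = Cs c \<tau> t" and Sn_scale: "Sn c (t * \<tau>) 1 * t = Sn c \<tau> t"
  by (auto simp: Cs_def Sn_def mult.commute)

text \<open>Applying the inverse of the fundamental matrix to \<open>(y, y')\<close> gives
  \<open>P\<close> and \<open>R\<close>, whose derivatives vanish; \<open>Cs_Sn_squares\<close> then
  recovers \<open>y\<close> from these constants.\<close>

lemma linear_ode_unique:
  fixes y :: "real \<Rightarrow> 'b::real_normed_vector"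
  assumes y: "\<And>s. (y has_vector_derivative y' s) (at s)"
    and y': "\<And>s. (y' has_vector_derivative (- c * \<tau>\<^sup>2) *\<^sub>R y s) (at s)"
  shows "y s = Cs c \<tau> s *\<^sub>R y 0 + Sn c \<tau> s *\<^sub>R y' 0"
proof -
  note d = derivative_eq_intros y y' DERIV_Cs DERIV_Sn
  define P where "P s = Cs c \<tau> s *\<^sub>R y s - Sn c \<tau> s *\<^sub>R y' s" for s
  define R where "R s = (c * \<tau>\<^sup>2 * Sn c \<tau> s) *\<^sub>R y s + Cs c \<tau> s *\<^sub>R y' s" for s
  have "(P has_vector_derivative 0) (at s)" for s
    unfolding P_def[abs_def] by (rule d refl | simp add: algebra_simps)+
  then obtain a where a: "\<And>s. P s = a"
    using has_vector_derivative_zero_constant[of UNIV P] by auto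
  have "(R has_vector_derivative 0) (at s)" for s
    unfolding R_def[abs_def] by (rule d refl | simp add: algebra_simps)+
  then obtain b where b: "\<And>s. R s = b"
    using has_vector_derivative_zero_constant[of UNIV R] by auto
  have "a = y 0" "b = y' 0" using a[of 0] b[of 0] by (simp_all add: P_def R_def)
  moreover have "Cs c \<tau> s *\<^sub>R P s + Sn c \<tau> s *\<^sub>R R s
      = (Cs c \<tau> s * Cs c \<tau> s + c * \<tau>\<^sup>2 * (Sn c \<tau> s * Sn c \<tau> s)) *\<^sub>R y s"
    by (simp add: P_def R_def algebra_simps)
  ultimately show ?thesis using Cs_Sn_squares[of \<tau> s] a b by simp
qed

text \<open>The acceleration is a multiple of the position. Differentiating
  \<open>qinner c y y = c\<close> twice identifies the factor as \<open>- c\<close> times the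
  squared speed of the curved part, which is constant, so that part solves the linear equation; the
  line factor moves uniformly.\<close>

lemma geodesic_eq:
  assumes "geodesic c \<gamma>" "\<gamma> 0 = x" "(\<gamma> has_vector_derivative v) (at 0)"
    and k: "qinner c (Qpart v) (Qpart v) = \<tau>\<^sup>2"
  shows "\<gamma> s = Cs c \<tau> s *\<^sub>R Qpart x + Sn c \<tau> s *\<^sub>R Qpart v + (snd x + s * snd v) *\<^sub>R d_dt"
proof -
  obtain \<gamma>' \<gamma>'' where QR: "\<And>s. \<gamma> s \<in> QR c" and d: "\<And>s. (\<gamma> has_vector_derivative \<gamma>' s) (at s)"
    "\<And>s. (\<gamma>' has_vector_derivative \<gamma>'' s) (at s)" and tan: "\<And>s. tan_proj c (\<gamma> s) (\<gamma>'' s) = 0"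
    using assms(1) unfolding geodesic_def by blast
  have g0: "\<gamma>' 0 = v" using assms(3) d(1)[of 0] vector_derivative_unique_at by blast
  let ?y = "\<lambda>s. Qpart (\<gamma> s)" and ?y' = "\<lambda>s. Qpart (\<gamma>' s)" and ?y'' = "\<lambda>s. Qpart (\<gamma>'' s)"
  note dQ = bounded_linear.has_vector_derivative[OF bounded_linear_Qpart]
  have dy: "(?y has_vector_derivative ?y' s) (at s)" "(?y' has_vector_derivative ?y'' s) (at s)" for s
    using d dQ by blast+
  have acc: "\<gamma>'' s = (c * qinner c (?y'' s) (?y s)) *\<^sub>R ?y s" for s
    using tan[of s] qinner_Qpart(2)[of c "\<gamma>'' s" "\<gamma> s"] by (simp add: tan_proj_alt)
  have y'': "?y'' s = (c * qinner c (?y'' s) (?y s)) *\<^sub>R ?y s" for s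
    using arg_cong[OF acc[of s], of Qpart] by simp
  have yy: "qinner c (?y s) (?y s) = c" for s using QR[of s] by (simp add: QR_alt)
  have 1: "qinner c (?y s) (?y' s) = 0" for s
  proof -
    have "((\<lambda>s. qinner c (?y s) (?y s)) has_vector_derivative
        qinner c (?y s) (?y' s) + qinner c (?y' s) (?y s)) (at s)"
      by (intro has_vector_derivative_qinner dy)
    then have "((\<lambda>s. c) has_vector_derivative
        qinner c (?y s) (?y' s) + qinner c (?y' s) (?y s)) (at s)" by (simp only: yy)
    then have "qinner c (?y s) (?y' s) + qinner c (?y' s) (?y s) = 0"
      using vector_derivative_unique_at has_vector_derivative_const by blast
    then show ?thesis by (simp add: qinner_commute)
  qed
  have 2: "qinner c (?y s) (?y'' s) = - qinner c (?y' s) (?y' s)" for s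
  proof -
    have "((\<lambda>s. qinner c (?y s) (?y' s)) has_vector_derivative
        qinner c (?y s) (?y'' s) + qinner c (?y' s) (?y' s)) (at s)"
      by (intro has_vector_derivative_qinner dy)
    then have "((\<lambda>s. 0) has_vector_derivative
        qinner c (?y s) (?y'' s) + qinner c (?y' s) (?y' s)) (at s)" by (simp only: 1)
    then have "qinner c (?y s) (?y'' s) + qinner c (?y' s) (?y' s) = 0"
      using vector_derivative_unique_at has_vector_derivative_const by blast
    then show ?thesis by simp
  qed
  have "((\<lambda>s. qinner c (?y' s) (?y' s)) has_vector_derivative 0) (at s)" for s
  proof -
    have "qinner c (?y' s) (?y'' s) = 0"
      using arg_cong[OF y''[of s], of "qinner c (?y' s)"] 1[of s]
      by (simp add: qinner_commute)
    then show ?thesis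
      using has_vector_derivative_qinner[OF dy(2)[of s] dy(2)[of s], of c]
      by (simp add: qinner_commute)
  qed
  then obtain k where "\<And>s. qinner c (?y' s) (?y' s) = k"
    using has_vector_derivative_zero_constant[of UNIV "\<lambda>s. qinner c (?y' s) (?y' s)"] by auto
  with k g0 have 3: "qinner c (?y' s) (?y' s) = \<tau>\<^sup>2" for s by metis
  have "?y'' s = (- c * \<tau>\<^sup>2) *\<^sub>R ?y s" for s
    using y''[of s] 2[of s] 3[of s] by (simp add: qinner_commute)
  then have y: "?y s = Cs c \<tau> s *\<^sub>R Qpart x + Sn c \<tau> s *\<^sub>R Qpart v"
    using linear_ode_unique[of ?y ?y' \<tau> s] dy assms(2) g0 by simp
  have snd'': "snd (\<gamma>'' s) = 0" for s
    using arg_cong[OF acc[of s], of snd] by simp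
  have ds: "((\<lambda>s. snd (\<gamma> s)) has_vector_derivative snd (\<gamma>' s)) (at s)"
       "((\<lambda>s. snd (\<gamma>' s)) has_vector_derivative snd (\<gamma>'' s)) (at s)" for s
    using bounded_linear.has_vector_derivative[OF bounded_linear_snd] d by blast+
  then obtain k where "\<And>s. snd (\<gamma>' s) = k"
    using has_vector_derivative_zero_constant[of UNIV "\<lambda>s. snd (\<gamma>' s)"] snd'' by auto
  with g0 have sv: "snd (\<gamma>' s) = snd v" for s by metis
  have "((\<lambda>s. snd (\<gamma> s) - s * snd v) has_vector_derivative 0) (at s)" for s
    using ds(1)[of s] sv by (auto intro!: derivative_eq_intros)
  then obtain k where k: "\<And>s. snd (\<gamma> s) - s * snd v = k"
    using has_vector_derivative_zero_constant[of UNIV "\<lambda>s. snd (\<gamma> s) - s * snd v"] by auto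
  then have "snd (\<gamma> s) = snd x + s * snd v"
    using k[of 0] k[of s] assms(2) by (simp add: algebra_simps)
  then show ?thesis using Qpart_decomp[of "\<gamma> s"] y by simp
qed

lemma geodesic_exists:
  assumes "x \<in> QR c" "v \<in> QR_tangent c x"
    and k: "qinner c (Qpart v) (Qpart v) = \<tau>\<^sup>2"
  defines "\<gamma> \<equiv> \<lambda>s. Cs c \<tau> s *\<^sub>R Qpart x + Sn c \<tau> s *\<^sub>R Qpart v + (snd x + s * snd v) *\<^sub>R d_dt"
  shows "geodesic c \<gamma>" "(\<gamma> has_vector_derivative v) (at 0)"
proof -
  define \<gamma>' where "\<gamma>' = (\<lambda>s. (- c * \<tau>\<^sup>2 * Sn c \<tau> s) *\<^sub>R Qpart x + Cs c \<tau> s *\<^sub>R Qpart v + snd v *\<^sub>R d_dt)"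
  have d: "(\<gamma> has_vector_derivative \<gamma>' s) (at s)"
    "(\<gamma>' has_vector_derivative (- c * \<tau>\<^sup>2) *\<^sub>R Qpart (\<gamma> s)) (at s)" for s
    unfolding \<gamma>'_def \<gamma>_def
    by (rule derivative_eq_intros DERIV_Cs DERIV_Sn refl | simp add: algebra_simps)+
  have "\<gamma>' 0 = v" using Qpart_decomp[of v] by (simp add: \<gamma>'_def)
  with d show "(\<gamma> has_vector_derivative v) (at 0)" by metis
  have xx: "qinner c (Qpart x) (Qpart x) = c" and
    xv: "qinner c (Qpart x) (Qpart v) = 0" "qinner c (Qpart v) (Qpart x) = 0"
    using assms(1,2) qinner_Qpart(2)[of c v x]
    by (simp_all add: QR_alt QR_tangent_alt qinner_commute)
  have unit: "qinner c (Qpart (\<gamma> s)) (Qpart (\<gamma> s)) = c" for s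
  proof -
    have "qinner c (Qpart (\<gamma> s)) (Qpart (\<gamma> s))
       = c * (Cs c \<tau> s * Cs c \<tau> s + c * \<tau>\<^sup>2 * (Sn c \<tau> s * Sn c \<tau> s))"
      using c by (auto simp: \<gamma>_def xx xv k)
    then show ?thesis by (simp add: Cs_Sn_squares)
  qed
  \<comment> \<open>The curve cannot change sheets: by the intermediate value theorem the last
    coordinate would vanish somewhere, where the unit condition would give a vector with square norm
    \<open>-1\<close>.\<close>
  have pos: "snd (fst (\<gamma> s)) > 0" if "c = -1" for s
  proof (rule ccontr)
    let ?h = "\<lambda>s. snd (fst (\<gamma> s))"
    assume "\<not> ?h s > 0"
    have cont: "continuous_on UNIV \<gamma>"
      using has_vector_derivative_continuous[OF d(1)]
      by (simp add: continuous_on_eq_continuous_at)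
    have "?h 0 > 0" using assms(1) that by (simp add: QR_alt \<gamma>_def d_dt_def Cs_def Sn_def)
    moreover have "connected (range ?h)"
      by (intro connected_continuous_image continuous_intros cont) simp
    ultimately obtain r where "?h r = 0"
      using \<open>\<not> ?h s > 0\<close> connectedD_interval[of "range ?h" "?h s" "?h 0" 0] by force
    moreover obtain a h' where "\<gamma> r = ((a, ?h r), h')" by (metis prod.collapse)
    ultimately have "a \<bullet> a = -1" using unit[of r] that
      by (simp add: qinner_def Qpart_def)
    then show False using inner_ge_zero[of a] by simp
  qed
  have "\<gamma> s \<in> QR c" for s using unit pos by (simp add: QR_alt)
  moreover have "tan_proj c (\<gamma> s) ((- c * \<tau>\<^sup>2) *\<^sub>R Qpart (\<gamma> s)) = 0" for s
    using c unit[of s] by (auto simp: tan_proj_alt)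
  ultimately show "geodesic c \<gamma>" unfolding geodesic_def
    by (intro conjI exI[of _ \<gamma>'] exI[of _ "\<lambda>s. (- c * \<tau>\<^sup>2) *\<^sub>R Qpart (\<gamma> s)"] allI d image_subsetI)
qed

lemma QR_exp_eq:
  assumes "x \<in> QR c" "v \<in> QR_tangent c x" "qinner c (Qpart v) (Qpart v) = \<tau>\<^sup>2"
  shows "QR_exp c x v = Cs c \<tau> 1 *\<^sub>R Qpart x + Sn c \<tau> 1 *\<^sub>R Qpart v + (snd x + snd v) *\<^sub>R d_dt"
  unfolding QR_exp_def
proof (rule the_equality)
  let ?g = "\<lambda>s. Cs c \<tau> s *\<^sub>R Qpart x + Sn c \<tau> s *\<^sub>R Qpart v + (snd x + s * snd v) *\<^sub>R d_dt"
  show "\<exists>\<gamma>. geodesic c \<gamma> \<and> \<gamma> 0 = x \<and> (\<gamma> has_vector_derivative v) (at 0) \<and>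
      \<gamma> 1 = Cs c \<tau> 1 *\<^sub>R Qpart x + Sn c \<tau> 1 *\<^sub>R Qpart v + (snd x + snd v) *\<^sub>R d_dt"
    using geodesic_exists[OF assms] Qpart_decomp[of x]
    by (intro exI[of _ ?g]) simp
qed (use geodesic_eq[of _ x v \<tau> 1] assms(3) in auto)

lemma parallel_map_eq:
  assumes "f p \<in> QR c" "\<eta> p \<in> QR_tangent c (f p)" "qinner c (Qpart (\<eta> p)) (Qpart (\<eta> p)) = \<tau>\<^sup>2"
  shows "parallel_map c f \<eta> t p
    = Cs c \<tau> t *\<^sub>R Qpart (f p) + Sn c \<tau> t *\<^sub>R Qpart (\<eta> p) + (snd (f p) + t * snd (\<eta> p)) *\<^sub>R d_dt"
proof -
  have "t *\<^sub>R \<eta> p \<in> QR_tangent c (f p)"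
    using assms(2) by (simp add: QR_tangent_alt)
  moreover have "qinner c (Qpart (t *\<^sub>R \<eta> p)) (Qpart (t *\<^sub>R \<eta> p)) = (t * \<tau>)\<^sup>2"
    using assms(3) by (simp add: power2_eq_square)
  ultimately show ?thesis
    unfolding parallel_map_def using QR_exp_eq[OF assms(1)]
    by (simp add: Cs_scale Sn_scale)
qed

end

section \<open>Hypersurfaces in a chart\<close>

lemma smooth_on_has_derivative:
  assumes "smooth_on S F" "x \<in> S"
  shows "(F has_derivative frechet_derivative F (at x)) (at x)"
proof -
  have "Ck_on (Suc 0) S F" using assms(1) unfolding smooth_on_def by blast
  then show ?thesis using assms(2) by (simp add: frechet_derivative_works)
qed

lemma smooth_on_frechet_has_derivative:
  assumes "smooth_on S F" "x \<in> S"
  shows "((\<lambda>y. frechet_derivative F (at y) u) has_derivative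
    frechet_derivative (\<lambda>y. frechet_derivative F (at y) u) (at x)) (at x)"
proof -
  have "Ck_on (Suc (Suc 0)) S F" using assms(1) unfolding smooth_on_def by blast
  then show ?thesis using assms(2) by (simp add: frechet_derivative_works)
qed

lemma has_derivative_constant_on_open:
  assumes "(h has_derivative D) (at x)" "open S" "x \<in> S" "\<And>y. y \<in> S \<Longrightarrow> h y = k"
  shows "D v = 0"
proof -
  have "(h has_derivative (\<lambda>v. 0)) (at x)"
    by (rule has_derivative_transform_within_open[OF has_derivative_const[of k] assms(2,3)])
      (simp add: assms(4))
  then show ?thesis using assms(1) has_derivative_unique by metis
qed

text \<open>An immersion and its unit normal in coordinates, so that the local geometry takes place
  on an open set of \<open>real^'n\<close>. The locale is interpreted both for \<open>f\<close> and
  for its parallel hypersurfaces.\<close>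

locale chart_hypersurface =
  fixes c :: real and S :: "(real^'n::finite) set" and F N :: "real^'n \<Rightarrow> 'n ambient"
  assumes c: "c \<in> {1, -1}"
    and open_S: "open S"
    and smooth_F: "smooth_on S F" and smooth_N: "smooth_on S N"
    and F_QR: "\<And>x. x \<in> S \<Longrightarrow> F x \<in> QR c"
    and N_tangent: "\<And>x. x \<in> S \<Longrightarrow> N x \<in> QR_tangent c (F x)"
    and N_unit: "\<And>x. x \<in> S \<Longrightarrow> qinner c (N x) (N x) = 1"
    and inj_DF: "\<And>x. x \<in> S \<Longrightarrow> inj (frechet_derivative F (at x))"
    and N_normal: "\<And>x v. x \<in> S \<Longrightarrow> qinner c (N x) (frechet_derivative F (at x) v) = 0"
begin

abbreviation DF where "DF x \<equiv> frechet_derivative F (at x)"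
abbreviation DN where "DN x \<equiv> frechet_derivative N (at x)"

definition shape :: "real^'n \<Rightarrow> real^'n \<Rightarrow> real^'n" where
  "shape x v = (THE w. DF x w = - tan_proj c (F x) (DN x v))"

definition metric :: "real^'n \<Rightarrow> real^'n \<Rightarrow> real^'n \<Rightarrow> real" where
  "metric x u v = qinner c (DF x u) (DF x v)"

definition T :: "real^'n \<Rightarrow> real^'n" where
  "T x = (THE v. \<exists>\<nu>. d_dt = DF x v + \<nu> *\<^sub>R N x)"

context
  fixes x assumes x: "x \<in> S"
begin

section \<open>Structure equations of a hypersurface in flat coordinates\<close>

lemma DF: "(F has_derivative DF x) (at x)" and DN: "(N has_derivative DN x) (at x)"
  using smooth_on_has_derivative smooth_F smooth_N x by blast+

lemma linear_DF: "linear (DF x)" and linear_DN: "linear (DN x)"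
  using DF DN has_derivative_linear by blast+

lemmas D_simps = linear_add[OF linear_DF] linear_scale[OF linear_DF] linear_0[OF linear_DF]
  linear_add[OF linear_DN] linear_scale[OF linear_DN] linear_0[OF linear_DN]

lemma c_square_simps [simp]: "c * c = 1" "c * (c * r) = r" "c \<noteq> 0"
  using c by auto

lemma FF: "qinner c (Qpart (F x)) (Qpart (F x)) = c"
  using F_QR[OF x] by (simp add: QR_alt)

lemma NF: "qinner c (N x) (Qpart (F x)) = 0"
  using N_tangent[OF x] by (simp add: QR_tangent_alt)

lemma has_derivative_Qpart_F: "((\<lambda>x. Qpart (F x)) has_derivative (\<lambda>v. Qpart (DF x v))) (at x)"
  by (rule bounded_linear.has_derivative[OF bounded_linear_Qpart DF])

lemma DF_tangent: "qinner c (DF x v) (Qpart (F x)) = 0"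
proof -
  have "((\<lambda>x. qinner c (Qpart (F x)) (Qpart (F x))) has_derivative
     (\<lambda>v. qinner c (Qpart (F x)) (Qpart (DF x v)) + qinner c (Qpart (DF x v)) (Qpart (F x)))) (at x)"
    by (intro has_derivative_qinner has_derivative_Qpart_F)
  from has_derivative_constant_on_open[OF this open_S x, of c v]
  show ?thesis using F_QR by (simp add: QR_alt qinner_commute[of c "Qpart (F x)"] qinner_Qpart(2)[of c "DF x v"])
qed

lemma DN_N: "qinner c (DN x v) (N x) = 0"
proof -
  have "((\<lambda>x. qinner c (N x) (N x)) has_derivative
     (\<lambda>v. qinner c (N x) (DN x v) + qinner c (DN x v) (N x))) (at x)"
    by (intro has_derivative_qinner DN)
  from has_derivative_constant_on_open[OF this open_S x, of 1 v]
  show ?thesis using N_unit by (simp add: qinner_commute)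
qed

text \<open>The normal component of \<open>DF v\<close> vanishes, so its spherical part pairs with \<open>N\<close> to \<open>- \<nu> dt(v)\<close>.\<close>

lemma DN_F: "qinner c (DN x v) (Qpart (F x)) = snd (N x) * snd (DF x v)"
proof -
  have "((\<lambda>x. qinner c (N x) (Qpart (F x))) has_derivative
     (\<lambda>v. qinner c (N x) (Qpart (DF x v)) + qinner c (DN x v) (Qpart (F x)))) (at x)"
    by (intro has_derivative_qinner DN has_derivative_Qpart_F)
  from has_derivative_constant_on_open[OF this open_S x, of 0 v]
  have "qinner c (N x) (Qpart (DF x v)) + qinner c (DN x v) (Qpart (F x)) = 0"
    using N_tangent by (simp add: QR_tangent_alt)
  then show ?thesis
    using N_normal[OF x, of v] qinner_Qpart(3)[of c "N x" "DF x v"] qinner_Qpart(2)[of c "N x" "DF x v"]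
    by simp
qed

text \<open>The coefficients \<open>((v, a), b)\<close> form a space of the same type as the ambient
  one, so the linear map assembling them is surjective once it is injective. Injectivity follows by
  pairing with the two normals and from \<open>inj_DF\<close>.\<close>

lemma frame:
  obtains v a b where "w = DF x v + a *\<^sub>R N x + b *\<^sub>R Qpart (F x)"
proof -
  define \<Phi> :: "'n ambient \<Rightarrow> 'n ambient"
    where "\<Phi> z = DF x (fst (fst z)) + snd (fst z) *\<^sub>R N x + snd z *\<^sub>R Qpart (F x)" for z
  have lin: "linear \<Phi>"
    by (rule linearI) (simp_all add: \<Phi>_def D_simps algebra_simps)
  have "z = 0" if "\<Phi> z = 0" for z
  proof -
    obtain v a b where z: "z = ((v, a), b)" by (metis surj_pair)
    have 0: "DF x v + a *\<^sub>R N x + b *\<^sub>R Qpart (F x) = 0" using that by (simp add: \<Phi>_def z)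
    have "b = 0" using arg_cong[OF 0, of "\<lambda>w. qinner c w (Qpart (F x))"]
      by (simp add: DF_tangent NF FF)
    moreover have "a = 0" using arg_cong[OF 0, of "\<lambda>w. qinner c (N x) w"]
      by (simp add: N_normal[OF x] NF N_unit[OF x])
    ultimately have "DF x v = DF x 0" using 0 by (simp add: D_simps)
    then have "v = 0" using inj_DF[OF x] by (meson injD)
    with \<open>a = 0\<close> \<open>b = 0\<close> show ?thesis by (simp add: z zero_prod_def)
  qed
  then have "inj \<Phi>" using linear_injective_0[OF lin] by blast
  then have "surj \<Phi>" using linear_injective_imp_surjective[OF lin] by simp
  then obtain z where "w = \<Phi> z" by blast
  then show ?thesis using that by (auto simp: \<Phi>_def)
qed

lemma tangent_normal_decomp:
  assumes "qinner c w (Qpart (F x)) = 0"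
  obtains v where "w = DF x v + qinner c w (N x) *\<^sub>R N x"
proof -
  obtain v a b where w: "w = DF x v + a *\<^sub>R N x + b *\<^sub>R Qpart (F x)" by (rule frame)
  have "b = 0" using assms by (simp add: w DF_tangent NF FF)
  moreover have "qinner c w (N x) = a"
    using \<open>b = 0\<close> N_normal[OF x, of v] N_unit[OF x] by (simp add: w qinner_commute)
  ultimately show ?thesis using that[of v] w by simp
qed

text \<open>The right-hand side is orthogonal to both normals, hence lies in the range of
  \<open>DF x\<close>; injectivity makes the description in \<open>shape\<close> unique.\<close>

lemma DF_shape: "DF x (shape x v) = - tan_proj c (F x) (DN x v)"
proof -
  let ?w = "- tan_proj c (F x) (DN x v)"
  have "qinner c ?w (Qpart (F x)) = 0" by (simp add: tan_proj_alt FF)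
  moreover have "qinner c ?w (N x) = 0"
    using NF by (simp add: tan_proj_alt DN_N qinner_commute[of c "Qpart (F x)" "N x"])
  ultimately obtain u where u: "?w = DF x u" by (metis tangent_normal_decomp add.right_neutral scale_zero_left)
  have "shape x v = u" unfolding shape_def u using inj_DF[OF x] by (auto simp: inj_eq)
  then show ?thesis using u by simp
qed

text \<open>The Weingarten formula in flat space; the additional term is the component along the
  position vector, computed in \<open>DN_F\<close>.\<close>

lemma DN_eq: "DN x v = - DF x (shape x v) + (c * snd (N x) * snd (DF x v)) *\<^sub>R Qpart (F x)"
  by (simp add: DF_shape tan_proj_alt DN_F mult.assoc)

lemma DF_eqD: "DF x u = DF x v \<Longrightarrow> u = v"
  using inj_DF[OF x] by (meson injD)

lemma linear_shape: "linear (shape x)"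
  by (rule linearI; rule DF_eqD) (simp_all add: DF_shape D_simps tan_proj_alt algebra_simps)

lemma symmetric_form_metric: "symmetric_form (metric x)"
proof
  show "bilinear (metric x)"
    by (auto simp: bilinear_def metric_def D_simps intro!: linearI)
  show "metric x u v = metric x v u" for u v by (simp add: metric_def qinner_commute)
  show "metric x u u > 0" if "u \<noteq> 0" for u
  proof -
    have "DF x u \<noteq> 0" using that DF_eqD[of u 0] by (auto simp: D_simps)
    then show ?thesis unfolding metric_def
      using qinner_tangent_pos[OF c F_QR[OF x]] DF_tangent by (simp add: QR_tangent_alt)
  qed
qed

lemma shape_metric: "metric x (shape x u) v = - qinner c (DN x u) (DF x v)"
  by (simp add: metric_def DF_shape tan_proj_alt DF_tangent qinner_commute[of c "Qpart (F x)"])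

text \<open>Differentiating \<open>qinner c (N y) (DF y v) = 0\<close> along \<open>u\<close>
  expresses the second fundamental form through the second derivative of \<open>F\<close>, which is
  symmetric.\<close>

lemma shape_self_adjoint: "metric x (shape x u) v = metric x u (shape x v)"
proof -
  let ?D2 = "\<lambda>u. frechet_derivative (\<lambda>y. DF y u) (at x)"
  have "qinner c (N x) (?D2 v u) + qinner c (DN x u) (DF x v) = 0" for u v
  proof -
    have "((\<lambda>y. qinner c (N y) (DF y v)) has_derivative
      (\<lambda>u. qinner c (N x) (?D2 v u) + qinner c (DN x u) (DF x v))) (at x)"
      by (intro has_derivative_qinner DN smooth_on_frechet_has_derivative[OF smooth_F x])
    from has_derivative_constant_on_open[OF this open_S x, of 0 u] N_normal show ?thesis by simp
  qed
  from this[of v u] this[of u v] smooth_on_imp_second_derivative_symmetric[OF smooth_F open_S x, of u v]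
  have "qinner c (DN x u) (DF x v) = qinner c (DN x v) (DF x u)" by simp
  then show ?thesis
    using shape_metric[of u v] shape_metric[of v u] by (simp add: metric_def qinner_commute)
qed

lemma DF_T: "DF x (T x) = d_dt - snd (N x) *\<^sub>R N x"
proof -
  obtain v where v: "d_dt = DF x v + snd (N x) *\<^sub>R N x"
    using tangent_normal_decomp[of d_dt] by (auto simp: Qpart_def)
  have "T x = v" unfolding T_def
  proof (rule the_equality)
    fix u assume "\<exists>\<nu>. d_dt = DF x u + \<nu> *\<^sub>R N x"
    then obtain \<nu> where u: "d_dt = DF x u + \<nu> *\<^sub>R N x" by blast
    have "\<nu> = snd (N x)"
      using arg_cong[OF u, of "qinner c (N x)"] by (simp add: N_normal[OF x] N_unit[OF x])
    then show "u = v" using u v by (intro DF_eqD) (metis add_right_cancel)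
  qed (use v in blast)
  then show ?thesis using v by (simp add: algebra_simps)
qed

lemma metric_T: "metric x v (T x) = snd (DF x v)"
  by (simp add: metric_def DF_T N_normal[OF x] qinner_commute[of c _ "N x"])

lemma metric_T_T: "metric x (T x) (T x) = 1 - (snd (N x))\<^sup>2"
  by (simp add: metric_T DF_T power2_eq_square) (simp add: d_dt_def)

text \<open>With \<open>shape_self_adjoint\<close> this says that the gradient of
  \<open>\<nu>\<close> is \<open>- A T\<close>.\<close>

lemma snd_DN: "snd (DN x v) = - metric x (shape x v) (T x)"
  by (simp add: DN_eq metric_T)

end

end

section \<open>The parallel hypersurfaces of a chart\<close>

text \<open>The principal curvatures of the parallel hypersurface at distance \<open>t\<close>, where \<open>k\<close> is the index
  of the principal direction \<open>T\<close>.\<close>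

definition parallel_curvature :: "real \<Rightarrow> real \<Rightarrow> ('n \<Rightarrow> real) \<Rightarrow> 'n \<Rightarrow> real \<Rightarrow> 'n \<Rightarrow> real" where
  "parallel_curvature c \<tau> m k t i = (if i = k then m k / (1 - t * m k)
     else (m i * Cs c \<tau> t + c * \<tau>\<^sup>2 * Sn c \<tau> t) / (Cs c \<tau> t - m i * Sn c \<tau> t))"

locale principal_chart = chart_hypersurface c S F N
  for c :: real and S :: "(real^'n::finite) set" and F N :: "real^'n \<Rightarrow> 'n ambient" +
  assumes T_nonzero: "\<And>x. x \<in> S \<Longrightarrow> T x \<noteq> 0"
    and T_eigenvector: "\<And>x. x \<in> S \<Longrightarrow> \<exists>l. shape x (T x) = l *\<^sub>R T x"
begin

abbreviation "\<nu> x \<equiv> snd (N x)"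

text \<open>The norm of \<open>T\<close> by \<open>metric_T_T\<close>, written through
  \<open>\<nu>\<close> so that its differential follows from that of \<open>N\<close>.\<close>

definition \<tau> :: "real^'n \<Rightarrow> real" where "\<tau> x = sqrt (1 - (\<nu> x)\<^sup>2)"

text \<open>\<open>P t\<close> is the parallel hypersurface at distance \<open>t\<close>, \<open>E t\<close> its unit normal (the velocity of the normal
  geodesics), and \<open>T' t\<close> the tangential part of \<open>\<partial>/\<partial>t\<close> along it.\<close>

definition P :: "real \<Rightarrow> real^'n \<Rightarrow> 'n ambient" where
  "P t x = Cs c (\<tau> x) t *\<^sub>R Qpart (F x) + Sn c (\<tau> x) t *\<^sub>R Qpart (N x) + (snd (F x) + t * \<nu> x) *\<^sub>R d_dt"

definition E :: "real \<Rightarrow> real^'n \<Rightarrow> 'n ambient" where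
  "E t x = (- c * (\<tau> x)\<^sup>2 * Sn c (\<tau> x) t) *\<^sub>R Qpart (F x) + Cs c (\<tau> x) t *\<^sub>R Qpart (N x) + \<nu> x *\<^sub>R d_dt"

definition T' :: "real \<Rightarrow> real^'n \<Rightarrow> 'n ambient" where
  "T' t x = (c * \<nu> x * (\<tau> x)\<^sup>2 * Sn c (\<tau> x) t) *\<^sub>R Qpart (F x) - (\<nu> x * Cs c (\<tau> x) t) *\<^sub>R Qpart (N x)
     + (\<tau> x)\<^sup>2 *\<^sub>R d_dt"

text \<open>A basis adapted to the normal geodesics: the derivative of \<open>P t\<close> along each
  \<open>b i\<close> remains a multiple of a single vector, \<open>T' t x\<close> for
  \<open>i = k\<close> and \<open>DF x (b i)\<close> otherwise.\<close>

definition eigenframe :: "real^'n \<Rightarrow> ('n \<Rightarrow> real^'n) \<Rightarrow> ('n \<Rightarrow> real) \<Rightarrow> 'n \<Rightarrow> bool" where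
  "eigenframe x b m k \<longleftrightarrow> inj b \<and> independent (range b) \<and> span (range b) = UNIV \<and> b k = T x \<and>
     (\<forall>i. shape x (b i) = m i *\<^sub>R b i) \<and> (\<forall>i. i \<noteq> k \<longrightarrow> metric x (b i) (T x) = 0)"

context
  fixes x assumes x: "x \<in> S"
begin

lemma exists_eigenframe: obtains b m k where "eigenframe x b m k"
proof -
  obtain l where "shape x (T x) = l *\<^sub>R T x" using T_eigenvector x by blast
  note exists_indexed_eigenbasis[where G="metric x" and A="shape x" and T="T x" and l=l,
      OF symmetric_form_metric[OF x] linear_shape[OF x] shape_self_adjoint[OF x] T_nonzero[OF x] this]
  then show ?thesis
  proof cases
    case (1 b m k)
    then show ?thesis by (intro that[of b m k]) (simp add: eigenframe_def, metis)
  qed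
qed

lemma one_minus_nu_pos: "1 - (\<nu> x)\<^sup>2 > 0"
  using symmetric_form.pos[OF symmetric_form_metric[OF x] T_nonzero[OF x]] metric_T_T[OF x] by simp

lemma tau_pos: "\<tau> x > 0" and tau_square: "(\<tau> x)\<^sup>2 = 1 - \<nu> x * \<nu> x"
  using one_minus_nu_pos by (simp_all add: \<tau>_def power2_eq_square)

lemma QN_QN: "qinner c (Qpart (N x)) (Qpart (N x)) = (\<tau> x)\<^sup>2"
  using N_unit[OF x] qinner_Qpart(3)[of c "N x" "N x"] by (simp add: tau_square)

lemma QN_QF: "qinner c (Qpart (N x)) (Qpart (F x)) = 0" "qinner c (Qpart (F x)) (Qpart (N x)) = 0"
  using NF[OF x] qinner_Qpart(2)[of c "N x" "F x"] by (simp_all add: qinner_commute)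

lemma parallel_map_P:
  assumes "f p = F x" "\<eta> p = N x"
  shows "parallel_map c f \<eta> t p = P t x"
  using parallel_map_eq[OF c, of f p \<eta>] F_QR[OF x] N_tangent[OF x] QN_QN
  by (simp add: assms P_def)

section \<open>Differentials of the parallel map and of its normal\<close>

lemma has_derivative_tau:
  "(\<tau> has_derivative (\<lambda>v. - \<nu> x * snd (DN x v) / \<tau> x)) (at x)"
proof -
  have 1: "((\<lambda>y. \<nu> y) has_derivative (\<lambda>v. snd (DN x v))) (at x)"
    by (rule bounded_linear.has_derivative[OF bounded_linear_snd DN[OF x]])
  have 2: "((\<lambda>z. sqrt (1 - z\<^sup>2)) has_real_derivative - \<nu> x / \<tau> x) (at (\<nu> x))"
    unfolding \<tau>_def using one_minus_nu_pos
    by (auto intro!: derivative_eq_intros simp: field_simps)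
  show ?thesis unfolding \<tau>_def[abs_def]
    using DERIV_compose_FDERIV[OF 2 1] by (simp add: \<tau>_def mult.commute)
qed

abbreviation "d\<tau> v \<equiv> - \<nu> x * snd (DN x v) / \<tau> x"

lemma Qpart_DN: "((\<lambda>y. Qpart (N y)) has_derivative (\<lambda>v. Qpart (DN x v))) (at x)"
  and Qpart_DF: "((\<lambda>y. Qpart (F y)) has_derivative (\<lambda>v. Qpart (DF x v))) (at x)"
  and snd_DN': "((\<lambda>y. \<nu> y) has_derivative (\<lambda>v. snd (DN x v))) (at x)"
  and snd_DF': "((\<lambda>y. snd (F y)) has_derivative (\<lambda>v. snd (DF x v))) (at x)"
  using bounded_linear.has_derivative[OF bounded_linear_Qpart] bounded_linear.has_derivative[OF bounded_linear_snd]
    DN[OF x] DF[OF x] by blast+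

lemma has_derivative_Cs:
  "((\<lambda>y. Cs c (\<tau> y) t) has_derivative (\<lambda>v. d\<tau> v * (- c * \<tau> x * t * Sn c (\<tau> x) t))) (at x)"
  by (rule DERIV_compose_FDERIV[OF DERIV_Cs_param[OF c] has_derivative_tau])

lemma has_derivative_Sn:
  "((\<lambda>y. Sn c (\<tau> y) t) has_derivative (\<lambda>v. d\<tau> v * ((t * Cs c (\<tau> x) t - Sn c (\<tau> x) t) / \<tau> x))) (at x)"
  by (rule DERIV_compose_FDERIV[OF DERIV_Sn_param[OF c tau_pos] has_derivative_tau])

text \<open>The product rule applied to \<open>P t\<close>; terms with \<open>d\<tau>\<close> come
  from the dependence of \<open>Cs\<close> and \<open>Sn\<close> on the point through
  \<open>\<tau>\<close>.\<close>

definition DP :: "real \<Rightarrow> real^'n \<Rightarrow> 'n ambient" where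
  "DP t v = (d\<tau> v * (- c * \<tau> x * t * Sn c (\<tau> x) t)) *\<^sub>R Qpart (F x) + Cs c (\<tau> x) t *\<^sub>R Qpart (DF x v)
    + (d\<tau> v * ((t * Cs c (\<tau> x) t - Sn c (\<tau> x) t) / \<tau> x)) *\<^sub>R Qpart (N x) + Sn c (\<tau> x) t *\<^sub>R Qpart (DN x v)
    + (snd (DF x v) + t * snd (DN x v)) *\<^sub>R d_dt"

definition DE :: "real \<Rightarrow> real^'n \<Rightarrow> 'n ambient" where
  "DE t v = (- c * (2 * \<tau> x * d\<tau> v * Sn c (\<tau> x) t +
        (\<tau> x)\<^sup>2 * (d\<tau> v * ((t * Cs c (\<tau> x) t - Sn c (\<tau> x) t) / \<tau> x)))) *\<^sub>R Qpart (F x)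
    + (- c * (\<tau> x)\<^sup>2 * Sn c (\<tau> x) t) *\<^sub>R Qpart (DF x v)
    + (d\<tau> v * (- c * \<tau> x * t * Sn c (\<tau> x) t)) *\<^sub>R Qpart (N x) + Cs c (\<tau> x) t *\<^sub>R Qpart (DN x v)
    + snd (DN x v) *\<^sub>R d_dt"

lemma has_derivative_P: "(P t has_derivative DP t) (at x)"
  unfolding P_def[abs_def] DP_def[abs_def]
  by (rule has_derivative_Cs has_derivative_Sn Qpart_DN Qpart_DF snd_DN' snd_DF' derivative_eq_intros refl)+
    (auto simp: fun_eq_iff algebra_simps)

lemma has_derivative_E: "(E t has_derivative DE t) (at x)"
  unfolding E_def[abs_def] DE_def[abs_def]
  by (rule has_derivative_Cs has_derivative_Sn Qpart_DN Qpart_DF snd_DN' snd_DF'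
      has_derivative_tau derivative_eq_intros refl)+
    (use tau_pos in \<open>auto simp: fun_eq_iff algebra_simps power2_eq_square\<close>)

text \<open>Along an eigenvector in \<open>T\<^sup>\<bottom>\<close> both \<open>\<tau>\<close> and
  the height are stationary, and \<open>DN\<close> is \<open>- \<mu>\<close> times
  \<open>DF\<close>. What remains is the Jacobi field with initial value \<open>1\<close> and
  initial slope \<open>- \<mu>\<close>, and minus its slope is the numerator of the parallel
  curvature.\<close>

lemma DP_DE_orthogonal:
  assumes "shape x v = \<mu> *\<^sub>R v" "metric x v (T x) = 0"
  shows "DP t v = (Cs c (\<tau> x) t - \<mu> * Sn c (\<tau> x) t) *\<^sub>R DF x v"
    and "DE t v = - (\<mu> * Cs c (\<tau> x) t + c * (\<tau> x)\<^sup>2 * Sn c (\<tau> x) t) *\<^sub>R DF x v"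
proof -
  have s: "snd (DF x v) = 0" using assms(2) metric_T[OF x] by simp
  have n: "DN x v = - \<mu> *\<^sub>R DF x v" using DN_eq[OF x, of v] s assms(1) by (simp add: D_simps[OF x])
  have q: "Qpart (DF x v) = DF x v" using Qpart_decomp[of "DF x v"] s by simp
  show "DP t v = (Cs c (\<tau> x) t - \<mu> * Sn c (\<tau> x) t) *\<^sub>R DF x v"
    by (simp add: DP_def n s q algebra_simps)
  show "DE t v = - (\<mu> * Cs c (\<tau> x) t + c * (\<tau> x)\<^sup>2 * Sn c (\<tau> x) t) *\<^sub>R DF x v"
    by (simp add: DE_def n s q algebra_simps)
qed

text \<open>The terms from \<open>d\<tau>\<close> combine with the others into the linear factor
  \<open>1 - t * l\<close>, as the Jacobi operator vanishes on \<open>T\<close>. The term with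
  \<open>Qpart (P t x)\<close> is normal to \<open>QR c\<close> and disappears under
  \<open>tan_proj\<close>.\<close>

lemma DP_DE_T:
  assumes "shape x (T x) = l *\<^sub>R T x"
  shows "DP t (T x) = (1 - t * l) *\<^sub>R T' t x"
    and "DE t (T x) = - l *\<^sub>R T' t x + (c * \<nu> x * (\<tau> x)\<^sup>2 * (1 - t * l)) *\<^sub>R Qpart (P t x)"
proof -
  have f: "DF x (T x) = (\<tau> x)\<^sup>2 *\<^sub>R d_dt - \<nu> x *\<^sub>R Qpart (N x)"
  proof -
    have "DF x (T x) = d_dt - \<nu> x *\<^sub>R (Qpart (N x) + \<nu> x *\<^sub>R d_dt)"
      using DF_T[OF x] Qpart_decomp[of "N x"] by metis
    then show ?thesis by (simp add: tau_square algebra_simps)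
  qed
  have sd: "snd (d_dt::'n ambient) = 1" by (simp add: d_dt_def)
  have s: "snd (DF x (T x)) = (\<tau> x)\<^sup>2" by (simp add: f sd)
  have n: "DN x (T x) = - l *\<^sub>R DF x (T x) + (c * \<nu> x * (\<tau> x)\<^sup>2) *\<^sub>R Qpart (F x)"
    using DN_eq[OF x, of "T x"] s assms by (simp add: D_simps[OF x])
  have sn: "snd (DN x (T x)) = - l * (\<tau> x)\<^sup>2" by (simp add: n s)
  have dt: "d\<tau> (T x) = \<nu> x * l * \<tau> x" using tau_pos by (simp add: sn power2_eq_square)
  \<comment> \<open>Cancels the division by \<open>\<tau>\<close> in the parameter derivative of
    \<open>Sn\<close>, so that coefficients can be compared as polynomials.\<close>
  have e: "\<nu> x * l * \<tau> x * (r / \<tau> x) = \<nu> x * l * r" for r using tau_pos by simp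
  have QDN: "Qpart (DN x (T x)) = (l * \<nu> x) *\<^sub>R Qpart (N x) + (c * \<nu> x * (\<tau> x)\<^sup>2) *\<^sub>R Qpart (F x)"
    by (simp add: n f)
  have QDF: "Qpart (DF x (T x)) = - \<nu> x *\<^sub>R Qpart (N x)" by (simp add: f)
  have QP: "Qpart (P t x) = Cs c (\<tau> x) t *\<^sub>R Qpart (F x) + Sn c (\<tau> x) t *\<^sub>R Qpart (N x)"
    by (simp add: P_def)
  show "DP t (T x) = (1 - t * l) *\<^sub>R T' t x"
    unfolding DP_def dt unfolding e QDN QDF s sn T'_def
    by (simp add: algebra_simps power2_eq_square)
  show "DE t (T x) = - l *\<^sub>R T' t x + (c * \<nu> x * (\<tau> x)\<^sup>2 * (1 - t * l)) *\<^sub>R Qpart (P t x)"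
    unfolding DE_def dt unfolding e QDN QDF QP sn T'_def
    by (simp add: algebra_simps power2_eq_square)
qed


section \<open>Orthogonality relations along a parallel hypersurface\<close>

lemma QP: "Qpart (P t x) = Cs c (\<tau> x) t *\<^sub>R Qpart (F x) + Sn c (\<tau> x) t *\<^sub>R Qpart (N x)"
  by (simp add: P_def)

lemma Cs_Sn: "c * (\<tau> x)\<^sup>2 * (Sn c (\<tau> x) t * Sn c (\<tau> x) t) = 1 - Cs c (\<tau> x) t * Cs c (\<tau> x) t"
  using Cs_Sn_squares[OF c, of "\<tau> x" t] by simp

lemma E_unit: "qinner c (E t x) (E t x) = 1"
proof -
  let ?S = "Sn c (\<tau> x) t" and ?C = "Cs c (\<tau> x) t" and ?\<tau> = "(\<tau> x)\<^sup>2"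
  have "qinner c (E t x) (E t x) = ?\<tau> * (c * c * (c * ?\<tau> * (?S * ?S)) + ?C * ?C) + \<nu> x * \<nu> x"
    by (simp add: E_def FF[OF x] QN_QN QN_QF algebra_simps del: c_square_simps) (simp add: d_dt_def Qpart_def)
  also have "\<dots> = ?\<tau> + \<nu> x * \<nu> x" unfolding Cs_Sn by (simp add: c_square_simps[OF x])
  finally show ?thesis by (simp add: tau_square)
qed

lemma E_P: "qinner c (E t x) (Qpart (P t x)) = 0"
  by (simp add: E_def QP FF[OF x] QN_QN QN_QF c_square_simps[OF x] algebra_simps)

lemma T'_P: "qinner c (T' t x) (Qpart (P t x)) = 0"
  by (simp add: T'_def QP FF[OF x] QN_QN QN_QF c_square_simps[OF x] algebra_simps)

lemma E_T': "qinner c (E t x) (T' t x) = 0"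
proof -
  let ?S = "Sn c (\<tau> x) t" and ?C = "Cs c (\<tau> x) t" and ?\<tau> = "(\<tau> x)\<^sup>2"
  have "qinner c (E t x) (T' t x) = \<nu> x * ?\<tau> * (1 - c * c * (c * ?\<tau> * (?S * ?S)) - ?C * ?C)"
    by (simp add: E_def T'_def FF[OF x] QN_QN QN_QF algebra_simps) (simp add: d_dt_def Qpart_def)
  also have "\<dots> = 0" unfolding Cs_Sn by (simp add: c_square_simps[OF x])
  finally show ?thesis .
qed

lemma orthogonal_T_DF:
  assumes "metric x v (T x) = 0"
  shows "qinner c (DF x v) (Qpart (P t x)) = 0" "qinner c (E t x) (DF x v) = 0"
proof -
  have s: "snd (DF x v) = 0" using assms metric_T[OF x] by simp
  have q: "Qpart (DF x v) = DF x v" using Qpart_decomp[of "DF x v"] s by simp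
  have n: "qinner c (DF x v) (Qpart (N x)) = 0"
    using N_normal[OF x, of v] qinner_Qpart(3)[of c "DF x v" "N x"] s q by (simp add: qinner_commute)
  show "qinner c (DF x v) (Qpart (P t x)) = 0" by (simp add: QP n DF_tangent[OF x])
  show "qinner c (E t x) (DF x v) = 0"
    by (simp add: E_def s qinner_commute[of c _ "DF x v"] n DF_tangent[OF x])
qed

text \<open>A form of the Gauss lemma. By linearity it suffices to test an eigenframe, on which
  \<open>DP\<close> is a multiple of \<open>T'\<close> or of \<open>DF\<close>, both orthogonal to
  \<open>E\<close>.\<close>

lemma E_DP: "qinner c (E t x) (DP t v) = 0"
proof -
  obtain b m k where e: "eigenframe x b m k" by (rule exists_eigenframe)
  have lin: "linear (\<lambda>v. qinner c (E t x) (DP t v))"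
    using bilinear_qinner[of c] has_derivative_linear[OF has_derivative_P[of t]]
    unfolding bilinear_def by (intro linear_compose[of "DP t" "qinner c (E t x)", unfolded o_def]) blast+
  have "qinner c (E t x) (DP t w) = 0" if "w \<in> range b" for w
  proof -
    from that obtain i where w: "w = b i" by blast
    have s: "shape x (b i) = m i *\<^sub>R b i" using e by (simp add: eigenframe_def)
    show ?thesis
    proof (cases "i = k")
      case True
      then have "b i = T x" using e by (simp add: eigenframe_def)
      then show ?thesis using DP_DE_T(1)[of "m i" t] s by (simp add: w E_T')
    next
      case False
      then have "metric x (b i) (T x) = 0" using e by (simp add: eigenframe_def)
      then show ?thesis using DP_DE_orthogonal(1)[OF s] orthogonal_T_DF(2) by (simp add: w)
    qed
  qed
  moreover have "v \<in> span (range b)" using e by (simp add: eigenframe_def)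
  ultimately show ?thesis using linear_eq_0_on_span[OF lin] by blast
qed

end

text \<open>A parallel map read in a chart is only known to agree with \<open>P t\<close> on an open
  set, which is enough to determine its derivative there.\<close>

lemma parallel_derivatives:
  assumes H: "chart_hypersurface c S' F' N'" and "S' \<subseteq> S" "x \<in> S'"
    and F': "\<And>y. y \<in> S' \<Longrightarrow> F' y = P t y"
  shows "frechet_derivative F' (at x) = DP x t"
proof -
  interpret H: chart_hypersurface c S' F' N' by fact
  have x: "x \<in> S" using assms by blast
  have "(F' has_derivative DP x t) (at x)"
    by (rule has_derivative_transform_within_open[OF has_derivative_P[OF x] H.open_S \<open>x \<in> S'\<close>])
      (simp add: F')
  then show ?thesis using frechet_derivative_at by metis
qed

text \<open>Being isoparametric supplies some unit normal, to be compared with \<open>E t\<close>.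
  The tangential part of \<open>E t\<close> is orthogonal to itself by \<open>E_DP\<close>, so
  \<open>E t\<close> is a multiple of \<open>N'\<close>, and unit length fixes the factor up to
  sign.\<close>

lemma parallel_normal_sign:
  assumes H: "chart_hypersurface c S' F' N'" and "S' \<subseteq> S" "x \<in> S'"
    and F': "\<And>y. y \<in> S' \<Longrightarrow> F' y = P t y"
  obtains s where "s \<in> {1, -1}" "N' x = s *\<^sub>R E t x"
proof -
  interpret H: chart_hypersurface c S' F' N' by fact
  have x: "x \<in> S" using assms by blast
  note D = parallel_derivatives[OF assms(1-3) F']
  obtain v where v: "E t x = H.DF x v + qinner c (E t x) (N' x) *\<^sub>R N' x"
    using H.tangent_normal_decomp[OF \<open>x \<in> S'\<close>, of "E t x"] E_P[OF x] F'[OF \<open>x \<in> S'\<close>] by metis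
  define s where "s = qinner c (E t x) (N' x)"
  have "H.metric x v v = 0"
    using arg_cong[OF v, of "\<lambda>w. qinner c w (H.DF x v)"] E_DP[OF x, of t v] H.N_normal[OF \<open>x \<in> S'\<close>]
    by (simp add: H.metric_def D)
  then have "v = 0"
    using symmetric_form.zero_iff[OF H.symmetric_form_metric[OF \<open>x \<in> S'\<close>]] by simp
  then have E: "E t x = s *\<^sub>R N' x" using v H.D_simps(3)[OF \<open>x \<in> S'\<close>] by (simp add: s_def)
  then have ss: "s * s = 1" using E_unit[OF x, of t] H.N_unit[OF \<open>x \<in> S'\<close>] by simp
  then have "s = 1 \<or> s = -1" by (simp add: square_eq_1_iff)
  moreover have "N' x = s *\<^sub>R E t x" using ss by (simp add: E)
  ultimately show ?thesis using that by blast
qed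

text \<open>Up to the normal of \<open>QR c\<close>, \<open>DE\<close> is minus the parallel
  curvature times \<open>DP\<close> on each \<open>b i\<close>. The frame thus also diagonalizes the
  shape operator of the parallel hypersurface.\<close>

lemma parallel_trace:
  assumes H: "chart_hypersurface c S' F' N'" and "S' \<subseteq> S" "x \<in> S'"
    and F': "\<And>y. y \<in> S' \<Longrightarrow> F' y = P t y" and N': "\<And>y. y \<in> S' \<Longrightarrow> N' y = s *\<^sub>R E t y"
    and e: "eigenframe x b m k"
  shows "trace (matrix (chart_hypersurface.shape c F' N' x))
    = s * (\<Sum>i\<in>UNIV. parallel_curvature c (\<tau> x) m k t i)"
proof -
  interpret H: chart_hypersurface c S' F' N' by fact
  have x: "x \<in> S" using assms by blast
  note D = parallel_derivatives[OF assms(1-3) F']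
  have "(N' has_derivative (\<lambda>v. s *\<^sub>R DE x t v)) (at x)"
    by (rule has_derivative_transform_within_open[OF has_derivative_scaleR_right[OF has_derivative_E[OF x]]
          H.open_S \<open>x \<in> S'\<close>])
      (simp add: N')
  then have DN': "H.DN x = (\<lambda>v. s *\<^sub>R DE x t v)" using frechet_derivative_at by metis
  have "H.shape x (b i) = (s * parallel_curvature c (\<tau> x) m k t i) *\<^sub>R b i" for i
  proof (rule H.DF_eqD[OF \<open>x \<in> S'\<close>])
    have sh: "shape x (b i) = m i *\<^sub>R b i" using e by (simp add: eigenframe_def)
    have "b i \<noteq> 0" using e dependent_zero[of "range b"] by (auto simp: eigenframe_def)
    \<comment> \<open>Since \<open>F'\<close> is an immersion, \<open>DP\<close> does not vanish on
      the frame; this makes the denominators of \<open>parallel_curvature\<close> nonzero.\<close>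
    then have nz: "DP x t (b i) \<noteq> 0"
      using H.DF_eqD[OF \<open>x \<in> S'\<close>, of "b i" 0] H.D_simps(3)[OF \<open>x \<in> S'\<close>] by (auto simp: D)
    have "- tan_proj c (F' x) (s *\<^sub>R DE x t (b i)) = (s * parallel_curvature c (\<tau> x) m k t i) *\<^sub>R DP x t (b i)"
    proof (cases "i = k")
      case True
      then have bi: "b i = T x" using e by (simp add: eigenframe_def)
      note d = DP_DE_T[OF x sh[unfolded bi], of t]
      have PP: "qinner c (Qpart (P t x)) (Qpart (P t x)) = c"
        using H.FF[OF \<open>x \<in> S'\<close>] F'[OF \<open>x \<in> S'\<close>] by simp
      have nz: "1 - t * m i \<noteq> 0" using nz d(1) by (auto simp: bi)
      have "tan_proj c (F' x) (s *\<^sub>R DE x t (T x)) = - (s * m i) *\<^sub>R T' t x"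
        by (simp add: F'[OF \<open>x \<in> S'\<close>] tan_proj_alt d(2) T'_P[OF x] PP c_square_simps[OF x] algebra_simps)
      then show ?thesis using True nz
        unfolding bi d(1) by (simp add: parallel_curvature_def)
    next
      case False
      then have o: "metric x (b i) (T x) = 0" using e by (simp add: eigenframe_def)
      note d = DP_DE_orthogonal[OF x sh o, of t]
      have "Cs c (\<tau> x) t - m i * Sn c (\<tau> x) t \<noteq> 0" using nz d(1) by auto
      then show ?thesis using False
        by (simp add: F'[OF \<open>x \<in> S'\<close>] tan_proj_alt d orthogonal_T_DF(1)[OF x o] parallel_curvature_def)
          (simp add: algebra_simps)
    qed
    then show "H.DF x (H.shape x (b i)) = H.DF x ((s * parallel_curvature c (\<tau> x) m k t i) *\<^sub>R b i)"
      unfolding H.D_simps(2)[OF \<open>x \<in> S'\<close>] H.DF_shape[OF \<open>x \<in> S'\<close>] DN' by (simp add: D)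
  qed
  from trace_diagonal[OF H.linear_shape[OF \<open>x \<in> S'\<close>] _ this]
  show ?thesis using e by (simp add: eigenframe_def sum_distrib_left)
qed

lemma dim_eigenspace_shape:
  assumes "x \<in> S" "eigenframe x b m k"
  shows "dim {v. shape x v = r *\<^sub>R v} = card {i. m i = r}"
  using dim_eigenspace_diagonal[OF linear_shape[OF assms(1)], of b m r] assms(2)
  by (simp add: eigenframe_def)

end

section \<open>Principal curvatures and curvature sums\<close>

lemma sum_eq_of_card_eq:
  fixes m m' :: "'i::finite \<Rightarrow> real" and g :: "real \<Rightarrow> real"
  assumes "\<And>r. card {i. m i = r} = card {i. m' i = r}"
  shows "(\<Sum>i\<in>UNIV. g (m i)) = (\<Sum>i\<in>UNIV. g (m' i))"
proof -
  let ?R = "range m \<union> range m'"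
  have "(\<Sum>i\<in>UNIV. g (h i)) = (\<Sum>r\<in>?R. real (card {i. h i = r}) * g r)" if "range h \<subseteq> ?R" for h :: "'i \<Rightarrow> real"
  proof -
    have "(\<Sum>i\<in>UNIV. g (h i)) = (\<Sum>r\<in>?R. \<Sum>i\<in>{i\<in>UNIV. h i = r}. g (h i))"
      using that by (intro sum.group[symmetric]) auto
    then show ?thesis by simp
  qed
  from this[of m] this[of m'] show ?thesis using assms by simp
qed

text \<open>The Riccati equation at \<open>t = 0\<close>; \<open>c * \<tau>\<^sup>2\<close> is the
  sectional curvature of the plane spanned by the normal and a direction orthogonal to
  \<open>T\<close>.\<close>

lemma DERIV_parallel_curvature_0:
  assumes c: "c \<in> {1, -1}"
  shows "((\<lambda>t. parallel_curvature c \<tau> m k t i) has_real_derivative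
    (m i)\<^sup>2 + (if i = k then 0 else c * \<tau>\<^sup>2)) (at 0)"
  unfolding parallel_curvature_def
  by (cases "i = k")
    (auto intro!: derivative_eq_intros DERIV_Cs[OF c] DERIV_Sn[OF c]
      simp: Cs_0[OF c] Sn_0[OF c] power2_eq_square algebra_simps)

text \<open>The derivatives of both sums at \<open>0\<close> agree. Equal multiplicities cancel the
  sums of squares, leaving \<open>(n - 1) * c * \<tau>\<^sup>2\<close> with
  \<open>n - 1 > 0\<close>.\<close>

lemma tau_eq_of_curvature_sums_eq:
  fixes m m' :: "'n::finite \<Rightarrow> real"
  assumes c: "c \<in> {1, -1}" and n: "CARD('n) \<ge> 2" and "\<epsilon> > 0"
    and eq: "\<And>t. \<bar>t\<bar> < \<epsilon> \<Longrightarrow> (\<Sum>i\<in>UNIV. parallel_curvature c \<tau> m k t i)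
      = (\<Sum>i\<in>UNIV. parallel_curvature c \<tau>' m' k' t i)"
    and card: "\<And>r. card {i. m i = r} = card {i. m' i = r}"
  shows "\<tau>\<^sup>2 = \<tau>'\<^sup>2"
proof -
  let ?D = "\<lambda>\<tau> m k. \<Sum>i\<in>UNIV. (m i)\<^sup>2 + (if i = k then 0 else c * \<tau>\<^sup>2)"
  have D: "((\<lambda>t. \<Sum>i\<in>UNIV. parallel_curvature c \<tau> m k t i) has_real_derivative ?D \<tau> m k) (at 0)"
    for \<tau> :: real and m and k :: 'n
    by (intro DERIV_sum DERIV_parallel_curvature_0[OF c])
  have "((\<lambda>t. \<Sum>i\<in>UNIV. parallel_curvature c \<tau>' m' k' t i) has_real_derivative ?D \<tau> m k) (at 0)"
    unfolding has_field_derivative_def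
    by (rule has_derivative_transform_within_open[OF D[unfolded has_field_derivative_def], where s="ball 0 \<epsilon>"])
      (use \<open>\<epsilon> > 0\<close> eq in auto)
  then have "?D \<tau> m k = ?D \<tau>' m' k'" using D DERIV_unique by blast
  moreover have "?D \<tau> m k = (\<Sum>i\<in>UNIV. (m i)\<^sup>2) + (real CARD('n) - 1) * (c * \<tau>\<^sup>2)"
    for \<tau> :: real and m and k :: 'n
  proof -
    have "(\<Sum>i\<in>UNIV. if i = k then 0 else c * \<tau>\<^sup>2) = (\<Sum>i\<in>UNIV - {k}. c * \<tau>\<^sup>2)"
      by (intro sum.mono_neutral_cong_right) auto
    also have "\<dots> = (real CARD('n) - 1) * (c * \<tau>\<^sup>2)"
      using n by (simp add: card_Diff_singleton of_nat_diff)
    finally show ?thesis by (simp add: sum.distrib)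
  qed
  ultimately have "(real CARD('n) - 1) * (c * \<tau>\<^sup>2) = (real CARD('n) - 1) * (c * \<tau>'\<^sup>2)"
    using sum_eq_of_card_eq[OF card, of "\<lambda>r. r\<^sup>2"] by simp
  moreover have "real CARD('n) - 1 > 0" using n by simp
  ultimately show ?thesis using c by auto
qed

text \<open>Away from \<open>T\<close> the curvature sum is \<open>- D'/D\<close> for the Jacobi determinant \<open>D = \<Prod>(C - m i S)\<close>,
  which is \<open>S^(n-1)\<close> times the characteristic polynomial of the shape operator on \<open>T\<^sup>\<bottom>\<close>,
  evaluated at \<open>C/S\<close>.\<close>

lemma card_eq_of_curvature_sums_eq:
  fixes m m' :: "'n::finite \<Rightarrow> real"
  assumes c: "c \<in> {1, -1}" and "\<tau> > 0" and "\<epsilon> > 0"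
    and eq: "\<And>t. \<bar>t\<bar> < \<epsilon> \<Longrightarrow> (\<Sum>i\<in>UNIV. parallel_curvature c \<tau> m k t i)
      = (\<Sum>i\<in>UNIV. parallel_curvature c \<tau> m' k' t i)"
    and mk: "m k = 0" "m' k' = 0"
  shows "card {i. m i = r} = card {i. m' i = r}"
proof -
  let ?C = "Cs c \<tau>" and ?S = "Sn c \<tau>"
  note DC = DERIV_Cs[OF c, of \<tau>] and DS = DERIV_Sn[OF c, of \<tau>]
  define D where "D m k t = (\<Prod>i\<in>UNIV - {k}. ?C t - m i * ?S t)" for m and k :: 'n and t
  have contC: "isCont ?C t" and contS: "isCont ?S t" for t
    using DC DS DERIV_isCont by blast+
  have ev: "\<forall>\<^sub>F t in nhds 0. \<forall>i. ?C t - m i * ?S t > 0" for m :: "'n \<Rightarrow> real"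
  proof -
    have "\<forall>\<^sub>F t in nhds 0. ?C t - m i * ?S t > 0" for i
    proof -
      have "isCont (\<lambda>t. ?C t - m i * ?S t) 0" using contC contS by (intro continuous_intros)
      then have "((\<lambda>t. ?C t - m i * ?S t) \<longlongrightarrow> 1) (nhds 0)"
        using c by (simp add: continuous_at_imp_continuous_within isCont_def tendsto_nhds_iff)
      then show ?thesis by (rule order_tendstoD) simp
    qed
    then show ?thesis by (simp add: eventually_all_finite)
  qed
  obtain \<delta> where \<delta>: "\<delta> > 0" "\<delta> \<le> \<epsilon>" "\<And>t i. \<bar>t\<bar> < \<delta> \<Longrightarrow> ?C t - m i * ?S t > 0"
    "\<And>t i. \<bar>t\<bar> < \<delta> \<Longrightarrow> ?C t - m' i * ?S t > 0" "\<And>t. \<bar>t\<bar> < \<delta> \<Longrightarrow> ?C t > 0"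
  proof -
    have "\<forall>\<^sub>F t in nhds 0. (\<forall>i. ?C t - m i * ?S t > 0) \<and> (\<forall>i. ?C t - m' i * ?S t > 0)"
      using ev[of m] ev[of m'] by eventually_elim blast
    then obtain d where "d > 0" and d: "\<And>t. \<bar>t\<bar> < d \<Longrightarrow>
        (\<forall>i. ?C t - m i * ?S t > 0) \<and> (\<forall>i. ?C t - m' i * ?S t > 0)"
      unfolding eventually_nhds_metric by (auto simp: dist_real_def)
    show ?thesis
    proof (rule that[of "min d \<epsilon>"])
      \<comment> \<open>The function \<open>Cs\<close> is itself the factor with index
        \<open>k\<close>, because \<open>m k = 0\<close>.\<close>
      show "?C t > 0" if "\<bar>t\<bar> < min d \<epsilon>" for t
        using d[of t] that mk(1) by (metis diff_zero min_less_iff_conj mult_zero_left)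
    qed (use d \<open>d > 0\<close> \<open>\<epsilon> > 0\<close> in auto)
  qed
  \<comment> \<open>Logarithmic differentiation of the product. The omitted index \<open>k\<close>
    contributes zero to the full sum since \<open>m k = 0\<close>.\<close>
  have DD: "(D m k has_real_derivative - (\<Sum>i\<in>UNIV. parallel_curvature c \<tau> m k t i) * D m k t) (at t)"
    if "m k = 0" "\<And>i. ?C t - m i * ?S t > 0" for t m k
  proof -
    let ?f = "\<lambda>i t. ?C t - m i * ?S t" and ?f' = "\<lambda>i t. - (m i * ?C t + c * \<tau>\<^sup>2 * ?S t)"
    have f: "(?f i has_real_derivative ?f' i t) (at t)" for i
      by (auto intro!: derivative_eq_intros DC DS)
    have "(D m k has_real_derivative (\<Sum>i\<in>UNIV - {k}. ?f' i t * (\<Prod>j\<in>UNIV - {k} - {i}. ?f j t))) (at t)"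
      unfolding D_def[abs_def] by (rule has_field_derivative_prod) (rule f)
    also have "(\<Sum>i\<in>UNIV - {k}. ?f' i t * (\<Prod>j\<in>UNIV - {k} - {i}. ?f j t))
        = (\<Sum>i\<in>UNIV - {k}. - parallel_curvature c \<tau> m k t i * D m k t)"
    proof (rule sum.cong[OF refl])
      fix i assume i: "i \<in> UNIV - {k}"
      have "D m k t = ?f i t * (\<Prod>j\<in>UNIV - {k} - {i}. ?f j t)"
        unfolding D_def using i by (intro prod.remove) auto
      then show "?f' i t * (\<Prod>j\<in>UNIV - {k} - {i}. ?f j t) = - parallel_curvature c \<tau> m k t i * D m k t"
        using i that(2)[of i] by (simp add: parallel_curvature_def) (simp add: algebra_simps)
    qed
    also have "\<dots> = - (\<Sum>i\<in>UNIV - {k}. parallel_curvature c \<tau> m k t i) * D m k t"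
      by (simp add: sum_distrib_right sum_negf)
    also have "(\<Sum>i\<in>UNIV - {k}. parallel_curvature c \<tau> m k t i) = (\<Sum>i\<in>UNIV. parallel_curvature c \<tau> m k t i)"
      using that(1) by (intro sum.mono_neutral_left) (auto simp: parallel_curvature_def)
    finally show ?thesis .
  qed
  have Dpos: "D m k t > 0" if "\<And>i. ?C t - m i * ?S t > 0" for t m k
    unfolding D_def using that by (intro prod_pos) auto
  \<comment> \<open>Equal logarithmic derivatives make the quotient constant, and both determinants
    are \<open>1\<close> at \<open>t = 0\<close>.\<close>
  have Deq: "D m k t = D m' k' t" if t: "\<bar>t\<bar> < \<delta>" for t
  proof -
    have "((\<lambda>t. D m k t / D m' k' t) has_real_derivative 0) (at s)" if "\<bar>s\<bar> < \<delta>" for s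
    proof -
      have "D m' k' s \<noteq> 0" using Dpos[of s m' k', OF \<delta>(4)[OF that]] by simp
      then show ?thesis
        using DERIV_divide[OF DD[of m k s, OF mk(1) \<delta>(3)[OF that]] DD[of m' k' s, OF mk(2) \<delta>(4)[OF that]]] eq[of s] that \<delta>(2)
        by simp
    qed
    moreover have "convex {-\<delta><..<\<delta>}" by (rule convex_real_interval)
    ultimately have "\<exists>q. \<forall>s\<in>{-\<delta><..<\<delta>}. D m k s / D m' k' s = q"
      by (intro has_field_derivative_zero_constant) (auto simp: at_within_open[OF _ open_greaterThanLessThan])
    then obtain q where "\<forall>s\<in>{-\<delta><..<\<delta>}. D m k s / D m' k' s = q" by blast
    then have q: "D m k s / D m' k' s = q" if "\<bar>s\<bar> < \<delta>" for s
      using that by (simp add: abs_less_iff minus_less_iff)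
    have "q = 1" using q[of 0] \<delta>(1) by (simp add: D_def Cs_0[OF c] Sn_0[OF c])
    then show ?thesis using q[OF t] Dpos[of t m' k', OF \<delta>(4)[OF t]] by simp
  qed
  have Spos: "?S t > 0" if "0 < t" "t < \<delta>" for t
    using DERIV_pos_imp_increasing[of 0 t ?S] DS \<delta>(5) that c by force
  let ?Y = "(\<lambda>t. ?C t / ?S t) ` {0<..<\<delta>}"
  show ?thesis
  proof (rule card_eq_of_prod_eq)
    \<comment> \<open>The quotient \<open>Cs / Sn\<close> has derivative
      \<open>-1 / Sn\<^sup>2\<close>, so it is injective and takes infinitely many values on the
      interval.\<close>
    have "?C t / ?S t < ?C s / ?S s" if st: "0 < s" "s < t" "t < \<delta>" for s t
    proof (rule DERIV_neg_imp_decreasing[OF st(2)])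
      fix u assume u: "s \<le> u" "u \<le> t"
      have S: "?S u > 0" using Spos[of u] u st by simp
      have "((\<lambda>t. ?C t / ?S t) has_real_derivative
          ((- c * \<tau>\<^sup>2 * ?S u) * ?S u - ?C u * ?C u) / (?S u * ?S u)) (at u)"
        using DERIV_divide[OF DC[of u] DS[of u]] S by simp
      also have "(- c * \<tau>\<^sup>2 * ?S u) * ?S u - ?C u * ?C u = - 1"
        using Cs_Sn_squares[OF c, of \<tau> u] by (simp add: algebra_simps)
      finally show "\<exists>y. ((\<lambda>t. ?C t / ?S t) has_real_derivative y) (at u) \<and> y < 0"
        using S by (intro exI[of _ "-1 / (?S u * ?S u)"]) simp
    qed
    then have "inj_on (\<lambda>t. ?C t / ?S t) {0<..<\<delta>}"
      by (intro linorder_inj_onI) (auto, fastforce+)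
    moreover have "infinite {0<..<\<delta>}" using \<delta>(1) by simp
    ultimately show "infinite ?Y" using finite_image_iff by blast
  next
    fix y assume "y \<in> ?Y"
    then obtain t where t: "0 < t" "t < \<delta>" and y: "y = ?C t / ?S t" by auto
    have S: "?S t > 0" using Spos t by simp
    \<comment> \<open>The index with \<open>m k = 0\<close> contributes the factor \<open>y\<close>,
      which is therefore the same for both families even when \<open>k \<noteq> k'\<close>.\<close>
    have prod: "(\<Prod>i\<in>UNIV. y - m i) = y * D m k t / ?S t ^ (CARD('n) - 1)" if "m k = 0" for m k
    proof -
      have "(\<Prod>i\<in>UNIV. y - m i) = (y - m k) * (\<Prod>i\<in>UNIV - {k}. y - m i)"
        by (intro prod.remove) auto
      also have "(\<Prod>i\<in>UNIV - {k}. y - m i) = (\<Prod>i\<in>UNIV - {k}. (?C t - m i * ?S t) / ?S t)"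
        using S by (intro prod.cong) (auto simp: y field_simps)
      also have "\<dots> = D m k t / ?S t ^ (CARD('n) - 1)"
        by (simp add: prod_dividef D_def card_Diff_singleton)
      finally show ?thesis using that by simp
    qed
    show "(\<Prod>i\<in>UNIV. y - m i) = (\<Prod>i\<in>UNIV. y - m' i)"
      using prod[of m k, OF mk(1)] prod[of m' k', OF mk(2)] Deq[of t] t by simp
  qed
qed

section \<open>Passage to the manifold\<close>

locale atlas =
  fixes X :: "'m topology" and \<A> :: "('m, 'n::finite) chart set"
  assumes smooth_manifold: "smooth_manifold X \<A>"
begin

context
  fixes K assumes K: "K \<in> \<A>"
begin

abbreviation "coord \<equiv> snd K"
abbreviation "param \<equiv> inv_into (fst K) (snd K)"

lemma open_dom: "openin X (fst K)" and open_coord: "open (coord ` fst K)"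
  and homeo: "homeomorphic_map (subtopology X (fst K)) (top_of_set (coord ` fst K)) coord"
  using smooth_manifold K unfolding smooth_manifold_def by (auto simp: case_prod_beta)

lemma dom_subset: "fst K \<subseteq> topspace X"
  using open_dom openin_subset by blast

lemma inj_coord: "inj_on coord (fst K)"
  using homeomorphic_imp_injective_map[OF homeo] dom_subset by (simp add: inf_absorb2)

lemma param_coord: "p \<in> fst K \<Longrightarrow> param (coord p) = p"
  using inj_coord by (simp add: inv_into_f_f)

lemma open_coord_image:
  assumes "openin X W"
  shows "open (coord ` (fst K \<inter> W))"
proof -
  have "openin (subtopology X (fst K)) (fst K \<inter> W)"
    using assms by (simp add: openin_subtopology_Int2)
  then have "openin (top_of_set (coord ` fst K)) (coord ` (fst K \<inter> W))"
    using homeomorphic_imp_open_map[OF homeo] by (simp add: open_map_def)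
  then show ?thesis using open_coord openin_open_eq by blast
qed

lemma open_coord_preimage:
  assumes "open B"
  shows "openin X {q \<in> fst K. coord q \<in> B}"
proof -
  have "openin (top_of_set (coord ` fst K)) (coord ` fst K \<inter> B)"
    using assms by (rule openin_open_Int)
  then have "openin (subtopology X (fst K)) {q \<in> topspace (subtopology X (fst K)). coord q \<in> coord ` fst K \<inter> B}"
    using homeomorphic_imp_continuous_map[OF homeo] openin_continuous_map_preimage by blast
  also have "{q \<in> topspace (subtopology X (fst K)). coord q \<in> coord ` fst K \<inter> B} = {q \<in> fst K. coord q \<in> B}"
    using dom_subset by auto
  finally show ?thesis using open_dom openin_trans_full by blast
qed

lemma hypersurface_chart:
  assumes c: "c \<in> {1, -1}" and H: "hypersurface c X \<A> W f \<eta>"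
  shows "chart_hypersurface c (coord ` (fst K \<inter> W)) (f \<circ> param) (\<eta> \<circ> param)"
proof
  show "c \<in> {1, -1}" by (rule c)
  note h = H[unfolded hypersurface_def smooth_map_on_def]
  show "open (coord ` (fst K \<inter> W))" using open_coord_image h by blast
  show "smooth_on (coord ` (fst K \<inter> W)) (f \<circ> param)" "smooth_on (coord ` (fst K \<inter> W)) (\<eta> \<circ> param)"
    using h K by (auto simp: case_prod_beta)
  fix x assume "x \<in> coord ` (fst K \<inter> W)"
  then obtain p where p: "p \<in> fst K" "p \<in> W" "x = coord p" by blast
  note pc = param_coord[OF p(1)]
  show "(f \<circ> param) x \<in> QR c" "(\<eta> \<circ> param) x \<in> QR_tangent c ((f \<circ> param) x)"
    "qinner c ((\<eta> \<circ> param) x) ((\<eta> \<circ> param) x) = 1"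
    using h p(2) by (auto simp: p(3) pc)
  have "inj (dif K f p)" "\<forall>v. qinner c (\<eta> p) (dif K f p v) = 0"
    using h K p by blast+
  then show "inj (frechet_derivative (f \<circ> param) (at x))"
    "qinner c ((\<eta> \<circ> param) x) (frechet_derivative (f \<circ> param) (at x) v) = 0" for v
    by (simp_all add: dif_def p(3) pc)
qed

lemma shape_op_chart:
  assumes "chart_hypersurface c S (f \<circ> param) (\<eta> \<circ> param)" "p \<in> fst K"
  shows "shape_op c K f \<eta> p = chart_hypersurface.shape c (f \<circ> param) (\<eta> \<circ> param) (coord p)"
  using assms(2)
  by (simp add: fun_eq_iff shape_op_def chart_hypersurface.shape_def[OF assms(1)] dif_def param_coord)

end

end

locale isoparametric_hypersurface = atlas X \<A>
  for X :: "'m topology" and \<A> :: "('m, 'n::finite) chart set" +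
  fixes c :: real
    and g :: "('m, 'n) chart \<Rightarrow> 'm \<Rightarrow> real^'n \<Rightarrow> real^'n \<Rightarrow> real"
    and f \<eta> :: "'m \<Rightarrow> 'n ambient"
  assumes c: "c \<in> {1, -1}"
    and hypersurface: "hypersurface c X \<A> (topspace X) f \<eta>"
    and isometric: "isometric c \<A> g f"
    and isoparametric: "isoparametric c X \<A> f \<eta>"
    and T_principal: "T_principal_direction c \<A> f \<eta>"
begin

text \<open>Given by the normal alone, hence independent of the chart, so that values at points of
  different charts can be compared.\<close>

definition tau :: "'m \<Rightarrow> real" where "tau p = sqrt (1 - (snd (\<eta> p))\<^sup>2)"

definition En :: "real \<Rightarrow> 'm \<Rightarrow> 'n ambient" where
  "En t p = (- c * (tau p)\<^sup>2 * Sn c (tau p) t) *\<^sub>R Qpart (f p) + Cs c (tau p) t *\<^sub>R Qpart (\<eta> p)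
     + snd (\<eta> p) *\<^sub>R d_dt"

text \<open>Forgets the eigenbasis and keeps the principal curvatures with the index of
  \<open>T\<close>, all that the curvature sums depend on besides \<open>tau\<close>.\<close>

definition curvature_data :: "('m, 'n) chart \<Rightarrow> 'm \<Rightarrow> ('n \<Rightarrow> real) \<Rightarrow> 'n \<Rightarrow> bool" where
  "curvature_data K p m k \<longleftrightarrow> (\<exists>b. principal_chart.eigenframe c (f \<circ> inv_into (fst K) (snd K))
     (\<eta> \<circ> inv_into (fst K) (snd K)) (snd K p) b m k)"

context
  fixes K assumes K: "K \<in> \<A>"
begin

abbreviation "F \<equiv> f \<circ> inv_into (fst K) (snd K)"
abbreviation "N \<equiv> \<eta> \<circ> inv_into (fst K) (snd K)"

lemma chart_hypersurface: "chart_hypersurface c (snd K ` fst K) F N"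
  using hypersurface_chart[OF K c hypersurface] dom_subset[OF K] by (simp add: inf_absorb1)

lemma T_field_chart: "p \<in> fst K \<Longrightarrow> T_field K f \<eta> p = chart_hypersurface.T F N (snd K p)"
  by (simp add: T_field_def chart_hypersurface.T_def[OF chart_hypersurface] dif_def param_coord[OF K])

lemma principal_chart: "principal_chart c (snd K ` fst K) F N"
proof -
  interpret chart_hypersurface c "snd K ` fst K" F N by (rule chart_hypersurface)
  show ?thesis
  proof
    fix x assume "x \<in> snd K ` fst K"
    then obtain p where p: "p \<in> fst K" "x = snd K p" by blast
    have "T_field K f \<eta> p \<noteq> 0" "\<exists>r. shape_op c K f \<eta> p (T_field K f \<eta> p) = r *\<^sub>R T_field K f \<eta> p"
      using T_principal K p(1) unfolding T_principal_direction_def by blast+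
    then show "T x \<noteq> 0" "\<exists>l. shape x (T x) = l *\<^sub>R T x"
      using T_field_chart[OF p(1)] shape_op_chart[OF K chart_hypersurface p(1)] by (simp_all add: p(2))
  qed
qed

interpretation PC: principal_chart c "snd K ` fst K" F N by (rule principal_chart)

context
  fixes p assumes p: "p \<in> fst K"
begin

lemma coord_in: "snd K p \<in> snd K ` fst K" using p by blast

lemma tau_chart: "PC.\<tau> (snd K p) = tau p"
  by (simp add: PC.\<tau>_def tau_def param_coord[OF K p])

lemma tau_pos: "tau p > 0"
  using PC.tau_pos[OF coord_in] by (simp add: tau_chart)

lemma T_norm_eq: "T_norm g K f \<eta> p = tau p"
proof -
  have "g K p (T_field K f \<eta> p) (T_field K f \<eta> p)
      = qinner c (dif K f p (T_field K f \<eta> p)) (dif K f p (T_field K f \<eta> p))"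
    using isometric K p unfolding isometric_def by metis
  also have "\<dots> = PC.metric (snd K p) (PC.T (snd K p)) (PC.T (snd K p))"
    by (simp add: PC.metric_def dif_def T_field_chart[OF p])
  also have "\<dots> = 1 - (snd (\<eta> p))\<^sup>2"
    using PC.metric_T_T[OF coord_in] by (simp add: param_coord[OF K p])
  finally show ?thesis by (simp add: T_norm_def tau_def)
qed

lemma En_chart: "PC.E t (snd K p) = En t p"
  by (simp add: PC.E_def En_def tau_chart param_coord[OF K p])

lemma parallel_map_chart: "parallel_map c f \<eta> t p = PC.P t (snd K p)"
  by (rule PC.parallel_map_P[OF coord_in]) (simp_all add: param_coord[OF K p])

lemma exists_curvature_data: obtains m k where "curvature_data K p m k"
  using PC.exists_eigenframe[OF coord_in] unfolding curvature_data_def by metis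

lemma principal_multiplicity_eq:
  assumes "curvature_data K p m k"
  shows "principal_multiplicity c K f \<eta> p r = card {i. m i = r}"
  using assms PC.dim_eigenspace_shape[OF coord_in]
  unfolding curvature_data_def principal_multiplicity_def shape_op_chart[OF K chart_hypersurface p]
  by blast

end

text \<open>The sign is written as an inner product, which makes it a function of the point to which
  connectedness applies.\<close>

lemma parallel_normal_sign:
  assumes H: "hypersurface c X \<A> W (parallel_map c f \<eta> t) \<xi>" and p: "p \<in> fst K" "p \<in> W"
  shows "qinner c (\<xi> p) (En t p) \<in> {1, -1}" "\<xi> p = qinner c (\<xi> p) (En t p) *\<^sub>R En t p"
proof -
  let ?param = "inv_into (fst K) (snd K)"
  let ?S = "snd K ` (fst K \<inter> W)"
  have H': "chart_hypersurface c ?S (parallel_map c f \<eta> t \<circ> ?param) (\<xi> \<circ> ?param)"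
    by (rule hypersurface_chart[OF K c H])
  obtain s where s: "s \<in> {1, -1}" "(\<xi> \<circ> ?param) (snd K p) = s *\<^sub>R PC.E t (snd K p)"
    by (rule PC.parallel_normal_sign[OF H', of "snd K p" t])
      (use p in \<open>auto simp: param_coord[OF K] parallel_map_chart\<close>)
  then have \<xi>: "\<xi> p = s *\<^sub>R En t p" by (simp add: param_coord[OF K p(1)] En_chart[OF p(1)])
  moreover have "qinner c (En t p) (En t p) = 1"
    using PC.E_unit[OF coord_in[OF p(1)]] by (simp add: En_chart[OF p(1)])
  ultimately have e: "qinner c (\<xi> p) (En t p) = s" by simp
  show "qinner c (\<xi> p) (En t p) \<in> {1, -1}" "\<xi> p = qinner c (\<xi> p) (En t p) *\<^sub>R En t p"
    unfolding e using s(1) \<xi> by blast+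
qed

text \<open>The sign is continuous in the chart, and two values in \<open>{1, -1}\<close> at
  distance less than \<open>1\<close> coincide.\<close>

lemma normal_sign_locally_constant:
  assumes H: "hypersurface c X \<A> W (parallel_map c f \<eta> t) \<xi>" and p: "p \<in> fst K" "p \<in> W"
  shows "\<exists>V. openin X V \<and> p \<in> V \<and> (\<forall>q\<in>V \<inter> W. qinner c (\<xi> q) (En t q) = qinner c (\<xi> p) (En t p))"
proof -
  let ?param = "inv_into (fst K) (snd K)"
  let ?S = "snd K ` (fst K \<inter> W)"
  let ?h = "\<lambda>x. qinner c ((\<xi> \<circ> ?param) x) (PC.E t x)"
  interpret H: chart_hypersurface c ?S "parallel_map c f \<eta> t \<circ> ?param" "\<xi> \<circ> ?param"
    by (rule hypersurface_chart[OF K c H])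
  have pS: "snd K p \<in> ?S" using p by blast
  have "isCont ?h (snd K p)"
    using has_derivative_continuous[OF has_derivative_qinner[OF H.DN[OF pS] PC.has_derivative_E[OF coord_in[OF p(1)]]]]
    by simp
  then have "\<forall>\<^sub>F x in nhds (snd K p). dist (?h x) (?h (snd K p)) < 1"
    unfolding isCont_def tendsto_iff eventually_at_filter by (auto elim!: allE[of _ 1] eventually_mono)
  then obtain B where B: "open B" "snd K p \<in> B" "\<And>x. x \<in> B \<Longrightarrow> dist (?h x) (?h (snd K p)) < 1"
    unfolding eventually_nhds by blast
  let ?V = "{q \<in> fst K. snd K q \<in> B}"
  have "qinner c (\<xi> q) (En t q) = qinner c (\<xi> p) (En t p)" if q: "q \<in> ?V \<inter> W" for q
  proof -
    have "dist (qinner c (\<xi> q) (En t q)) (qinner c (\<xi> p) (En t p)) < 1"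
      using B(3)[of "snd K q"] q p by (simp add: param_coord[OF K] En_chart)
    then show ?thesis
      using parallel_normal_sign(1)[OF H, of q] parallel_normal_sign(1)[OF H p] q
      by (auto simp: dist_real_def)
  qed
  moreover have "p \<in> ?V" using B(2) p by simp
  ultimately show ?thesis using open_coord_preimage[OF K B(1)] by blast
qed

lemma parallel_trace:
  assumes H: "hypersurface c X \<A> W (parallel_map c f \<eta> t) \<xi>"
    and s: "\<And>q. q \<in> W \<Longrightarrow> qinner c (\<xi> q) (En t q) = s"
    and p: "p \<in> fst K" "p \<in> W" and m: "curvature_data K p m k"
  shows "trace (matrix (shape_op c K (parallel_map c f \<eta> t) \<xi> p))
    = s * (\<Sum>i\<in>UNIV. parallel_curvature c (tau p) m k t i)"
proof -
  let ?param = "inv_into (fst K) (snd K)"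
  let ?S = "snd K ` (fst K \<inter> W)"
  have H': "chart_hypersurface c ?S (parallel_map c f \<eta> t \<circ> ?param) (\<xi> \<circ> ?param)"
    by (rule hypersurface_chart[OF K c H])
  obtain b where b: "PC.eigenframe (snd K p) b m k" using m unfolding curvature_data_def by blast
  have "trace (matrix (chart_hypersurface.shape c (parallel_map c f \<eta> t \<circ> ?param) (\<xi> \<circ> ?param) (snd K p)))
    = s * (\<Sum>i\<in>UNIV. parallel_curvature c (PC.\<tau> (snd K p)) m k t i)"
  proof (rule PC.parallel_trace[OF H' _ _ _ _ b])
    fix y assume "y \<in> ?S"
    then obtain q where q: "q \<in> fst K" "q \<in> W" "y = snd K q" by blast
    show "(parallel_map c f \<eta> t \<circ> ?param) y = PC.P t y"
      using q by (simp add: param_coord[OF K] parallel_map_chart)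
    show "(\<xi> \<circ> ?param) y = s *\<^sub>R PC.E t y"
      using q parallel_normal_sign(2)[OF H q(1,2)] s[OF q(2)] by (simp add: param_coord[OF K] En_chart)
  qed (use p in auto)
  then show ?thesis by (simp add: shape_op_chart[OF K H' p(1)] tau_chart[OF p(1)])
qed

text \<open>Constancy of \<open>tau\<close> forces the derivative of \<open>\<nu>\<close> along
  \<open>T\<close> to vanish, and by \<open>snd_DN\<close> this derivative is \<open>- m k\<close>
  times the square norm of \<open>T\<close>.\<close>

lemma constant_tau_imp_T_curvature_0:
  assumes const: "\<And>q. q \<in> fst K \<Longrightarrow> tau q = r" and p: "p \<in> fst K" and m: "curvature_data K p m k"
  shows "m k = 0"
proof -
  let ?x = "snd K p" and ?S = "snd K ` fst K"
  obtain b where b: "PC.eigenframe ?x b m k" using m unfolding curvature_data_def by blast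
  have x: "?x \<in> ?S" using p by blast
  have S: "open ?S" by (rule open_coord[OF K])
  have const': "PC.\<tau> y = r" if "y \<in> ?S" for y using that const tau_chart by auto
  have "PC.d\<tau> ?x (PC.T ?x) = 0"
    using has_derivative_constant_on_open[OF PC.has_derivative_tau[OF x] S x const'] by blast
  then have "snd (N ?x) = 0 \<or> snd (PC.DN ?x (PC.T ?x)) = 0"
    using PC.tau_pos[OF x] by auto
  then have "snd (PC.DN ?x (PC.T ?x)) = 0"
  \<comment> \<open>If \<open>\<nu>\<close> vanishes at one point, constancy of
    \<open>1 - \<nu>\<^sup>2\<close> makes it vanish on the whole chart, so its differential is zero
    as well.\<close>
  proof
    assume 0: "snd (N ?x) = 0"
    have "snd (N y) = 0" if "y \<in> ?S" for y
      using PC.tau_square[OF that] PC.tau_square[OF x] const'[OF that] const'[OF x] 0 by simp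
    then show ?thesis
      using has_derivative_constant_on_open[OF PC.snd_DN'[OF x] S x] by blast
  qed
  moreover have "PC.shape ?x (PC.T ?x) = m k *\<^sub>R PC.T ?x"
    using b unfolding PC.eigenframe_def by metis
  ultimately have "m k * PC.metric ?x (PC.T ?x) (PC.T ?x) = 0"
    using PC.snd_DN[OF x, of "PC.T ?x"]
      symmetric_form.form_simps(5)[OF PC.symmetric_form_metric[OF x]] by simp
  then show ?thesis
    using symmetric_form.pos[OF PC.symmetric_form_metric[OF x] PC.T_nonzero[OF x]] by auto
qed

end

section \<open>From local comparison to global constancy\<close>

lemma chart_around: assumes "p \<in> topspace X" obtains K where "K \<in> \<A>" "p \<in> fst K"
  using assms smooth_manifold unfolding smooth_manifold_def by blast

text \<open>On the connected set \<open>W\<close> the normal \<open>\<xi>\<close> equals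
  \<open>En t\<close> up to one fixed sign. The trace is this sign times the curvature sum, and
  constant mean curvature fixes it for all points and charts; the sign cancels.\<close>

lemma curvature_sums_locally_constant:
  assumes "p \<in> topspace X"
  obtains W \<epsilon> where "openin X W" "p \<in> W" "\<epsilon> > 0"
    "\<And>K L q q' m m' k k' t. \<lbrakk>K \<in> \<A>; L \<in> \<A>; q \<in> fst K \<inter> W; q' \<in> fst L \<inter> W;
      curvature_data K q m k; curvature_data L q' m' k'; \<bar>t\<bar> < \<epsilon>\<rbrakk> \<Longrightarrow>
      (\<Sum>i\<in>UNIV. parallel_curvature c (tau q) m k t i) = (\<Sum>i\<in>UNIV. parallel_curvature c (tau q') m' k' t i)"
proof -
  obtain W \<epsilon> where W: "p \<in> W" "\<epsilon> > 0" and iso: "\<And>t. \<bar>t\<bar> < \<epsilon> \<Longrightarrow>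
      \<exists>\<xi>. hypersurface c X \<A> W (parallel_map c f \<eta> t) \<xi> \<and>
           constant_mean_curvature c \<A> W (parallel_map c f \<eta> t) \<xi>"
    using isoparametric assms unfolding isoparametric_def by blast
  \<comment> \<open>Openness of \<open>W\<close> is part of the hypersurface condition at
    \<open>t = 0\<close>.\<close>
  have op: "openin X W" using iso[of 0] W(2) unfolding hypersurface_def by auto
  have "(\<Sum>i\<in>UNIV. parallel_curvature c (tau q) m k t i) = (\<Sum>i\<in>UNIV. parallel_curvature c (tau q') m' k' t i)"
    if h: "K \<in> \<A>" "L \<in> \<A>" "q \<in> fst K \<inter> W" "q' \<in> fst L \<inter> W"
      "curvature_data K q m k" "curvature_data L q' m' k'" "\<bar>t\<bar> < \<epsilon>" for K L q q' m m' k k' t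
  proof -
    obtain \<xi> h where H: "hypersurface c X \<A> W (parallel_map c f \<eta> t) \<xi>" and
      mc: "\<And>K p. K \<in> \<A> \<Longrightarrow> p \<in> fst K \<inter> W \<Longrightarrow> mean_curvature c K (parallel_map c f \<eta> t) \<xi> p = h"
      using iso[OF h(7)] unfolding constant_mean_curvature_def by blast
    have conn: "connectedin X W" using H unfolding hypersurface_def by blast
    let ?s = "\<lambda>q. qinner c (\<xi> q) (En t q)"
    have s: "?s y = ?s q" if "y \<in> W" for y
    proof (rule connectedin_locally_constant[OF conn, where h="?s"])
      fix x assume "x \<in> W"
      then have "x \<in> topspace X" using conn connectedin_subset_topspace by blast
      then obtain K' where "K' \<in> \<A>" "x \<in> fst K'" by (rule chart_around)
      then show "\<exists>V. openin X V \<and> x \<in> V \<and> (\<forall>y\<in>V \<inter> W. ?s y = ?s x)"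
        using normal_sign_locally_constant[OF _ H] \<open>x \<in> W\<close> by blast
    qed (use that h in auto)
    have n: "real CARD('n) \<noteq> 0" by simp
    have "?s q * (\<Sum>i\<in>UNIV. parallel_curvature c (tau q) m k t i) = h * CARD('n)"
      using parallel_trace[OF h(1) H s _ _ h(5)] mc[OF h(1,3)] h(3) n
      by (simp add: mean_curvature_def field_simps)
    moreover have "?s q * (\<Sum>i\<in>UNIV. parallel_curvature c (tau q') m' k' t i) = h * CARD('n)"
      using parallel_trace[OF h(2) H s _ _ h(6)] mc[OF h(2,4)] h(4) n
      by (simp add: mean_curvature_def field_simps)
    moreover have "?s q \<noteq> 0" using parallel_normal_sign(1)[OF h(1) H, of q] h(3) by auto
    ultimately show ?thesis by (metis mult_left_cancel)
  qed
  then show ?thesis by (rule that[OF op W])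
qed

lemma connected: "connectedin X (topspace X)"
  using hypersurface unfolding hypersurface_def by blast

lemma constant_tau_if_constant_principal_curvatures:
  assumes n: "CARD('n) \<ge> 2" and const: "constant_principal_curvatures c \<A> f \<eta>"
    and "p \<in> topspace X" "q \<in> topspace X"
  shows "tau p = tau q"
proof (rule connectedin_locally_constant[OF connected assms(3,4)])
  fix x assume x: "x \<in> topspace X"
  obtain M where M: "\<And>K p r. K \<in> \<A> \<Longrightarrow> p \<in> fst K \<Longrightarrow> principal_multiplicity c K f \<eta> p r = M r"
    using const unfolding constant_principal_curvatures_def by blast
  obtain W \<epsilon> where W: "openin X W" "x \<in> W" "\<epsilon> > 0"
    and eq: "\<And>K L q q' m m' k k' t. \<lbrakk>K \<in> \<A>; L \<in> \<A>; q \<in> fst K \<inter> W; q' \<in> fst L \<inter> W;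
      curvature_data K q m k; curvature_data L q' m' k'; \<bar>t\<bar> < \<epsilon>\<rbrakk> \<Longrightarrow>
      (\<Sum>i\<in>UNIV. parallel_curvature c (tau q) m k t i) = (\<Sum>i\<in>UNIV. parallel_curvature c (tau q') m' k' t i)"
    using curvature_sums_locally_constant[OF x] by metis
  have "tau y = tau x" if y: "y \<in> W \<inter> topspace X" for y
  proof -
    obtain K where K: "K \<in> \<A>" "x \<in> fst K" using x by (rule chart_around)
    obtain L where L: "L \<in> \<A>" "y \<in> fst L" using y chart_around by blast
    obtain m k where m: "curvature_data K x m k" by (rule exists_curvature_data[OF K])
    obtain m' k' where m': "curvature_data L y m' k'" by (rule exists_curvature_data[OF L])
    have "(tau x)\<^sup>2 = (tau y)\<^sup>2"
    proof (rule tau_eq_of_curvature_sums_eq[OF c n W(3), of "tau x" m k "tau y" m' k'])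
      show "card {i. m i = r} = card {i. m' i = r}" for r
        using principal_multiplicity_eq[OF K m] principal_multiplicity_eq[OF L m'] M[OF K] M[OF L] by simp
    qed (use eq[OF K(1) L(1) _ _ m m'] K L W y in auto)
    then show ?thesis using tau_pos[OF K] tau_pos[OF L] by (simp add: power2_eq_iff)
  qed
  then show "\<exists>V. openin X V \<and> x \<in> V \<and> (\<forall>y\<in>V \<inter> topspace X. tau y = tau x)" using W by blast
qed

text \<open>With a common \<open>tau\<close> and vanishing curvature along \<open>T\<close>, equal
  curvature sums determine the multiplicities near each point. Connectedness then spreads this over
  the manifold.\<close>

lemma constant_principal_curvatures_if_constant_tau:
  assumes const: "\<And>p. p \<in> topspace X \<Longrightarrow> tau p = r"
  shows "constant_principal_curvatures c \<A> f \<eta>"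
proof -
  have const': "tau p = r" if "K \<in> \<A>" "p \<in> fst K" for K p
    using that const dom_subset by blast
  have loc: "\<exists>W. openin X W \<and> x \<in> W \<and> (\<forall>K\<in>\<A>. \<forall>L\<in>\<A>. \<forall>p\<in>fst K \<inter> W. \<forall>q\<in>fst L \<inter> W.
      principal_multiplicity c K f \<eta> p = principal_multiplicity c L f \<eta> q)" if x: "x \<in> topspace X" for x
  proof -
    obtain W \<epsilon> where W: "openin X W" "x \<in> W" "\<epsilon> > 0"
      and eq: "\<And>K L q q' m m' k k' t. \<lbrakk>K \<in> \<A>; L \<in> \<A>; q \<in> fst K \<inter> W; q' \<in> fst L \<inter> W;
        curvature_data K q m k; curvature_data L q' m' k'; \<bar>t\<bar> < \<epsilon>\<rbrakk> \<Longrightarrow>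
        (\<Sum>i\<in>UNIV. parallel_curvature c (tau q) m k t i) = (\<Sum>i\<in>UNIV. parallel_curvature c (tau q') m' k' t i)"
      using curvature_sums_locally_constant[OF x] by metis
    have "principal_multiplicity c K f \<eta> p s = principal_multiplicity c L f \<eta> q s"
      if h: "K \<in> \<A>" "L \<in> \<A>" "p \<in> fst K \<inter> W" "q \<in> fst L \<inter> W" for K L p q s
    proof -
      have K: "K \<in> \<A>" "p \<in> fst K" and L: "L \<in> \<A>" "q \<in> fst L" using h by auto
      obtain m k where m: "curvature_data K p m k" by (rule exists_curvature_data[OF K])
      obtain m' k' where m': "curvature_data L q m' k'" by (rule exists_curvature_data[OF L])
      have mk: "m k = 0" "m' k' = 0"
        using constant_tau_imp_T_curvature_0[OF K(1) const'[OF K(1)] K(2) m]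
          constant_tau_imp_T_curvature_0[OF L(1) const'[OF L(1)] L(2) m'] by blast+
      have r: "r > 0" using tau_pos[OF K] const'[OF K] by simp
      have "card {i. m i = s} = card {i. m' i = s}"
        by (rule card_eq_of_curvature_sums_eq[where m=m and k=k and m'=m' and k'=k', OF c r W(3) _ mk])
          (use eq[OF h m m'] const'[OF K] const'[OF L] in simp)
      then show ?thesis using principal_multiplicity_eq[OF K m] principal_multiplicity_eq[OF L m'] by simp
    qed
    then have "\<forall>K\<in>\<A>. \<forall>L\<in>\<A>. \<forall>p\<in>fst K \<inter> W. \<forall>q\<in>fst L \<inter> W.
      principal_multiplicity c K f \<eta> p = principal_multiplicity c L f \<eta> q"
      by (intro ballI ext)
    then show ?thesis using W(1,2) by (intro exI[of _ W] conjI)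
  qed
  \<comment> \<open>Multiplicities are formally attached to a chart. Choosing one chart at each
    point yields a function of the point alone.\<close>
  define ch where "ch p = (SOME K. K \<in> \<A> \<and> p \<in> fst K)" for p
  have ch: "ch p \<in> \<A>" "p \<in> fst (ch p)" if "p \<in> topspace X" for p
    using someI_ex[of "\<lambda>K. K \<in> \<A> \<and> p \<in> fst K"] chart_around[OF that] unfolding ch_def by blast+
  let ?M = "\<lambda>p. principal_multiplicity c (ch p) f \<eta> p"
  have M: "?M p = ?M q" if "p \<in> topspace X" "q \<in> topspace X" for p q
  proof (rule connectedin_locally_constant[OF connected that])
    fix x assume x: "x \<in> topspace X"
    obtain W where W: "openin X W" "x \<in> W" "\<And>K L p q. \<lbrakk>K \<in> \<A>; L \<in> \<A>; p \<in> fst K \<inter> W; q \<in> fst L \<inter> W\<rbrakk>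
        \<Longrightarrow> principal_multiplicity c K f \<eta> p = principal_multiplicity c L f \<eta> q"
      using loc[OF x] by metis
    have "?M y = ?M x" if "y \<in> W \<inter> topspace X" for y
      using W(3)[of "ch y" "ch x" y x] ch[of y] ch[OF x] that W(2) by simp
    then show "\<exists>V. openin X V \<and> x \<in> V \<and> (\<forall>y\<in>V \<inter> topspace X. ?M y = ?M x)" using W by blast
  qed
  \<comment> \<open>Local agreement, applied to two charts at the same point, shows that the choice
    of chart is immaterial.\<close>
  have M': "principal_multiplicity c K f \<eta> p = ?M p" if "K \<in> \<A>" "p \<in> fst K" for K p
  proof -
    have p: "p \<in> topspace X" using that dom_subset by blast
    then show ?thesis using loc[OF p] ch[OF p] that by blast
  qed
  show ?thesis
  proof (cases "topspace X = {}")
    case True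
    then show ?thesis unfolding constant_principal_curvatures_def using dom_subset by blast
  next
    case False
    then obtain p0 where p0: "p0 \<in> topspace X" by blast
    have "principal_multiplicity c K f \<eta> p s = ?M p0 s" if "K \<in> \<A>" "p \<in> fst K" for K p s
      using M'[OF that] M[of p p0] p0 dom_subset[OF that(1)] that(2) by auto
    then show ?thesis unfolding constant_principal_curvatures_def by blast
  qed
qed

end

theorem theorem5p1:
  fixes c :: real
    and X :: "'m topology"
    and \<A> :: "('m, 'n::finite) chart set"
    and g :: "('m, 'n) chart \<Rightarrow> 'm \<Rightarrow> real^'n \<Rightarrow> real^'n \<Rightarrow> real"
    and f \<eta> :: "'m \<Rightarrow> 'n ambient"
  assumes "c \<in> {1, -1}"
    and "CARD('n) \<ge> 2"
    and "smooth_manifold X \<A>"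
    and "riemannian_metric \<A> g"
    and "hypersurface c X \<A> (topspace X) f \<eta>"
    and "isometric c \<A> g f"
    and "isoparametric c X \<A> f \<eta>"
    and "T_principal_direction c \<A> f \<eta>"
  shows "constant_principal_curvatures c \<A> f \<eta> \<longleftrightarrow>
    (\<exists>r. \<forall>K\<in>\<A>. \<forall>p\<in>fst K. T_norm g K f \<eta> p = r)"
proof -
  interpret isoparametric_hypersurface X \<A> c g f \<eta>
    by unfold_locales (use assms in auto)
  show ?thesis
  proof
    assume const: "constant_principal_curvatures c \<A> f \<eta>"
    have "\<exists>r. \<forall>p\<in>topspace X. tau p = r"
      using constant_tau_if_constant_principal_curvatures[OF assms(2) const] by metis
    then show "\<exists>r. \<forall>K\<in>\<A>. \<forall>p\<in>fst K. T_norm g K f \<eta> p = r"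
      using T_norm_eq dom_subset by (metis subsetD)
  next
    assume "\<exists>r. \<forall>K\<in>\<A>. \<forall>p\<in>fst K. T_norm g K f \<eta> p = r"
    then obtain r where "\<And>K p. K \<in> \<A> \<Longrightarrow> p \<in> fst K \<Longrightarrow> tau p = r" using T_norm_eq by metis
    then have "tau p = r" if "p \<in> topspace X" for p using chart_around[OF that] by metis
    then show "constant_principal_curvatures c \<A> f \<eta>"
      by (rule constant_principal_curvatures_if_constant_tau)
  qed
qed

end
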